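(* Let $X\subset\mathbb{R}^n$ be a closed algebraic set with degree of $\mathbb{R}$-uniruledness at most $d_1$, and let $f:X\to\mathbb{R}^m$ be a generically finite polynomial map of degree $d_2$. Then the set $S_f$ of points at which $f$ is not proper is also $\mathbb{R}$-uniruled. Moreover, its degree of $\mathbb{R}$-uniruledness is at most $2d_1d_2$.
   Context: A real polynomially parametric curve of degree at most $d$ in a semialgebraic set $X\subset\mathbb{R}^n$ is the image of a non-constant real polynomial map $\mathbb{R}\to X$ of degree at most $d$ (the degree of a polynomial map is the maximum of the degrees of its components). A closed semialgebraic set $X\subset\mathbb{R}^n$ has degree of $\mathbb{R}$-uniruledness at most $d$ if for every $x\in X$ there is a real polynomially parametric curve $l_x\subset X$ of degree at most $d$ passing through $x$. A closed semialgebraic set is $\mathbb{R}$-uniruled if it has degree of $\mathbb{R}$-uniruledness at most $d$ for some $d$. By convention the empty set is $\mathbb{R}$-uniruled, with degree of uniruledness zero. A polynomial map $f$ on a semialgebraic set is generically finite if its infinite fibers cover only a nowhere dense subset of the source. For a closed semialgebraic set $X\subset\mathbb{R}^n$ and a polynomial map $f:X\to\mathbb{R}^m$, $f$ is not proper at $y\in\mathbb{R}^m$ if there is no neighborhood $U$ of $y$ such that $f^{-1}(\overline{U})$ is compact; $S_f$ is the set of all $y\in\overline{f(X)}$ at which $f$ is not proper. It is a closed semialgebraic set. *)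

theory Defs
  imports
    "HOL-Analysis.Analysis"
    "HOL-Library.Poly_Mapping"
    "HOL-Computational_Algebra.Polynomial"
begin

text \<open>
  Real polynomials in variables indexed by a finite type \<open>'n\<close>: a finitely supported map from
  exponent vectors to coefficients.
\<close>

type_synonym 'n mpoly = "('n \<Rightarrow>\<^sub>0 nat) \<Rightarrow>\<^sub>0 real"

definition mpoly_eval :: "'n::finite mpoly \<Rightarrow> real ^ 'n \<Rightarrow> real" where
  "mpoly_eval p x =
     (\<Sum>a\<in>Poly_Mapping.keys p.
        Poly_Mapping.lookup p a * (\<Prod>i\<in>UNIV. (x $ i) ^ Poly_Mapping.lookup a i))"

text \<open>The zero polynomial gets degree 0.\<close>

definition mpoly_degree :: "'n::finite mpoly \<Rightarrow> nat" where
  "mpoly_degree p =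
     Max (insert 0 ((\<lambda>a. \<Sum>i\<in>UNIV. Poly_Mapping.lookup a i) ` Poly_Mapping.keys p))"

definition algebraic_set :: "(real ^ 'n) set \<Rightarrow> bool" where
  "algebraic_set X \<longleftrightarrow> (\<exists>P :: 'n::finite mpoly set. X = {x. \<forall>p\<in>P. mpoly_eval p x = 0})"

text \<open>
  The smallest Boolean algebra of sets containing all \<open>{x. p x > 0}\<close>; the sets \<open>{x. p x = 0}\<close>
  arise as the complement of \<open>{x. p x > 0} \<union> {x. - p x > 0}\<close>.
\<close>

inductive semialgebraic :: "(real ^ 'n::finite) set \<Rightarrow> bool" where
  semialgebraic_pos: "semialgebraic {x. mpoly_eval p x > 0}"
| semialgebraic_Compl: "semialgebraic A \<Longrightarrow> semialgebraic (- A)"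
| semialgebraic_Un: "semialgebraic A \<Longrightarrow> semialgebraic B \<Longrightarrow> semialgebraic (A \<union> B)"

text \<open>Only the values of \<open>f\<close> on \<open>X\<close> matter: \<open>f\<close> represents a map defined on \<open>X\<close>.\<close>

definition polynomial_map_on ::
    "(real ^ 'n) set \<Rightarrow> (real ^ 'n \<Rightarrow> real ^ 'm) \<Rightarrow> nat \<Rightarrow> bool" where
  "polynomial_map_on X f d \<longleftrightarrow>
     (\<exists>F :: 'n::finite mpoly ^ 'm::finite.
        (\<forall>x\<in>X. f x = (\<chi> j. mpoly_eval (F $ j) x)) \<and>
        d = Max (range (\<lambda>j. mpoly_degree (F $ j))))"

definition poly_map :: "real poly ^ 'n \<Rightarrow> real \<Rightarrow> real ^ 'n::finite" where
  "poly_map p t = (\<chi> i. poly (p $ i) t)"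

definition poly_map_degree :: "real poly ^ 'n::finite \<Rightarrow> nat" where
  "poly_map_degree p = Max (range (\<lambda>i. Polynomial.degree (p $ i)))"

definition parametric_curve_in :: "(real ^ 'n::finite) set \<Rightarrow> nat \<Rightarrow> (real ^ 'n) set \<Rightarrow> bool" where
  "parametric_curve_in X d l \<longleftrightarrow>
     (\<exists>p. \<not> poly_map p constant_on UNIV \<and> range (poly_map p) \<subseteq> X \<and>
          poly_map_degree p \<le> d \<and> l = range (poly_map p))"

text \<open>In particular the empty set satisfies this with \<open>d = 0\<close>.\<close>

definition uniruledness_degree_le :: "(real ^ 'n::finite) set \<Rightarrow> nat \<Rightarrow> bool" where
  "uniruledness_degree_le X d \<longleftrightarrow>
     closed X \<and> semialgebraic X \<and> (\<forall>x\<in>X. \<exists>l. parametric_curve_in X d l \<and> x \<in> l)"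

definition R_uniruled :: "(real ^ 'n::finite) set \<Rightarrow> bool" where
  "R_uniruled X \<longleftrightarrow> (\<exists>d. uniruledness_degree_le X d)"

text \<open>Nowhere density is meant in the subspace topology of \<open>X\<close>.\<close>

definition nowhere_dense_in :: "'a::topological_space set \<Rightarrow> 'a set \<Rightarrow> bool" where
  "nowhere_dense_in X N \<longleftrightarrow> (top_of_set X) interior_of ((top_of_set X) closure_of N) = {}"

definition generically_finite_on :: "'a::topological_space set \<Rightarrow> ('a \<Rightarrow> 'b) \<Rightarrow> bool" where
  "generically_finite_on X f \<longleftrightarrow>
     nowhere_dense_in X {x \<in> X. infinite {z \<in> X. f z = f x}}"

text \<open>A neighbourhood of \<open>y\<close> is any set having \<open>y\<close> in its interior.\<close>

definition proper_at ::
    "'a::topological_space set \<Rightarrow> ('a \<Rightarrow> 'b::topological_space) \<Rightarrow> 'b \<Rightarrow> bool" where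
  "proper_at X f y \<longleftrightarrow> (\<exists>U. y \<in> interior U \<and> compact {x \<in> X. f x \<in> closure U})"

definition nonproper_set ::
    "'a::topological_space set \<Rightarrow> ('a \<Rightarrow> 'b::topological_space) \<Rightarrow> 'b set" where
  "nonproper_set X f = {y \<in> closure (f ` X). \<not> proper_at X f y}"

end

theory Submission
  imports Defs
begin

text \<open>
  A point \<open>y\<close> lies in \<open>S\<^sub>f\<close> iff there are points \<open>x\<^sub>k\<close> of \<open>X\<close> tending to infinity with
  \<open>f x\<^sub>k \<longlonglongrightarrow> y\<close>, and by generic finiteness the \<open>x\<^sub>k\<close> can be moved to points with a finite fibre. If
  \<open>p\<^sub>k\<close> parametrises a curve in \<open>X\<close> with \<open>p\<^sub>k 0 = x\<^sub>k\<close>, then \<open>f \<circ> p\<^sub>k\<close> is a non-constant polynomial map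
  of degree at most \<open>d1 * d2\<close>. After rescaling the parameter, its coefficients of positive degree have
  norms of sum 1, so that a subsequence converges to a non-constant polynomial map \<open>q\<close> with
  \<open>q 0 = y\<close>. The coefficients of \<open>p\<^sub>k\<close>, divided by their norm \<open>M\<^sub>k \<longlonglongrightarrow> \<infinity>\<close>, subconverge to a
  non-zero polynomial map, hence \<open>p\<^sub>k t\<close> tends to infinity for all but finitely many \<open>t\<close>. For these
  \<open>t\<close> we have \<open>q t \<in> S\<^sub>f\<close>, and \<open>S\<^sub>f\<close> is closed. This even gives the bound \<open>d1 * d2\<close>.

  That \<open>S\<^sub>f\<close> is semialgebraic is the Tarski-Seidenberg theorem, proved by Cohen's method: the roots
  of a polynomial with parameters are covered by finitely many functions \<open>e\<close> of the parameters such
  that the sign of every polynomial at \<open>e\<close> is a semialgebraic condition. An existential quantifier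
  then ranges over finitely many sample points, namely these roots, their midpoints and their
  translates by \<open>1\<close> and \<open>-1\<close>.
\<close>

section \<open>Quantifier elimination over the reals\<close>

text \<open>Environments are functions \<open>nat \<Rightarrow> real\<close>, so that projections need no change of type;
  \<open>case_nat x v\<close> adds a new variable in front.\<close>

inductive polyfun :: "((nat \<Rightarrow> real) \<Rightarrow> real) \<Rightarrow> bool" where
  polyfun_const: "polyfun (\<lambda>v. c)"
| polyfun_var: "polyfun (\<lambda>v. v i)"
| polyfun_add: "polyfun P \<Longrightarrow> polyfun Q \<Longrightarrow> polyfun (\<lambda>v. P v + Q v)"
| polyfun_mult: "polyfun P \<Longrightarrow> polyfun Q \<Longrightarrow> polyfun (\<lambda>v. P v * Q v)"

inductive semialg :: "((nat \<Rightarrow> real) \<Rightarrow> bool) \<Rightarrow> bool" where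
  semialg_pos: "polyfun P \<Longrightarrow> semialg (\<lambda>v. 0 < P v)"
| semialg_not: "semialg A \<Longrightarrow> semialg (\<lambda>v. \<not> A v)"
| semialg_disj: "semialg A \<Longrightarrow> semialg B \<Longrightarrow> semialg (\<lambda>v. A v \<or> B v)"

section \<open>Closure properties of polynomial functions and semialgebraic conditions\<close>

lemma polyfun_uminus: "polyfun P \<Longrightarrow> polyfun (\<lambda>v. - P v)"
  by (drule polyfun_mult[OF polyfun_const[of "-1"]]) simp

lemma polyfun_diff: "polyfun P \<Longrightarrow> polyfun Q \<Longrightarrow> polyfun (\<lambda>v. P v - Q v)"
  by (drule polyfun_uminus[of Q], drule (1) polyfun_add) simp

lemma polyfun_sum: "(\<And>i. i \<in> I \<Longrightarrow> polyfun (P i)) \<Longrightarrow> polyfun (\<lambda>v. \<Sum>i\<in>I. P i v)"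
  by (induction I rule: infinite_finite_induct) (auto intro: polyfun_const polyfun_add)

lemma polyfun_prod: "(\<And>i. i \<in> I \<Longrightarrow> polyfun (P i)) \<Longrightarrow> polyfun (\<lambda>v. \<Prod>i\<in>I. P i v)"
  by (induction I rule: infinite_finite_induct) (auto intro: polyfun_const polyfun_mult)

lemma polyfun_power: "polyfun P \<Longrightarrow> polyfun (\<lambda>v. P v ^ k)"
  by (induction k) (auto intro: polyfun_const polyfun_mult)

lemmas polyfun_intros = polyfun_const polyfun_var polyfun_add polyfun_mult polyfun_uminus
  polyfun_diff polyfun_sum polyfun_prod polyfun_power

lemma polyfun_reindex: "polyfun P \<Longrightarrow> polyfun (\<lambda>v. P (v \<circ> h))"
  by (induction rule: polyfun.induct) (auto intro: polyfun_intros)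

lemma semialg_reindex: "semialg A \<Longrightarrow> semialg (\<lambda>v. A (v \<circ> h))"
proof (induction rule: semialg.induct)
  case (semialg_pos P)
  show ?case by (rule semialg.semialg_pos[OF polyfun_reindex[OF semialg_pos]])
qed (rule semialg_not semialg_disj; assumption)+

lemma semialg_conj: "semialg A \<Longrightarrow> semialg B \<Longrightarrow> semialg (\<lambda>v. A v \<and> B v)"
  by (drule semialg_not, drule semialg_not[of B], drule (1) semialg_disj, drule semialg_not) simp

lemma semialg_imp: "semialg A \<Longrightarrow> semialg B \<Longrightarrow> semialg (\<lambda>v. A v \<longrightarrow> B v)"
  by (drule semialg_not, drule (1) semialg_disj) simp

lemma semialg_const: "semialg (\<lambda>v. c)"
  using semialg_pos[OF polyfun_const[of "if c then 1 else 0"]] by (cases c) auto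

lemma semialg_less: "polyfun P \<Longrightarrow> polyfun Q \<Longrightarrow> semialg (\<lambda>v. P v < Q v)"
  by (drule (1) polyfun_diff[of Q], drule semialg_pos) simp

lemma semialg_bex: "finite I \<Longrightarrow> (\<And>i. i \<in> I \<Longrightarrow> semialg (A i)) \<Longrightarrow> semialg (\<lambda>v. \<exists>i\<in>I. A i v)"
proof (induction I rule: finite_induct)
  case (insert i I)
  then show ?case using semialg_disj[of "A i"] by simp
qed (simp add: semialg_const)

lemma semialg_ball: "finite I \<Longrightarrow> (\<And>i. i \<in> I \<Longrightarrow> semialg (A i)) \<Longrightarrow> semialg (\<lambda>v. \<forall>i\<in>I. A i v)"
proof (induction I rule: finite_induct)
  case (insert i I)
  then show ?case using semialg_conj[of "A i"] by simp
qed (simp add: semialg_const)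

section \<open>Univariate polynomials with parameters\<close>

definition ppoly :: "((nat \<Rightarrow> real) \<Rightarrow> real poly) \<Rightarrow> bool" where
  "ppoly p \<longleftrightarrow> (\<exists>d. \<forall>v. degree (p v) \<le> d) \<and> (\<forall>j. polyfun (\<lambda>v. coeff (p v) j))"

lemma ppoly_monom: "polyfun c \<Longrightarrow> ppoly (\<lambda>v. monom (c v) k)"
  unfolding ppoly_def
proof (intro conjI allI exI[of _ k] degree_monom_le)
  fix j assume "polyfun c" then show "polyfun (\<lambda>v. coeff (monom (c v) k) j)"
    by (cases "k = j") (auto intro: polyfun_const)
qed

lemma ppoly_const: "polyfun c \<Longrightarrow> ppoly (\<lambda>v. [:c v:])"
  using ppoly_monom[of c 0] by (simp add: monom_0)

lemma ppoly_add: assumes "ppoly p" "ppoly q" shows "ppoly (\<lambda>v. p v + q v)"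
proof -
  obtain d e where "\<And>v. degree (p v) \<le> d" "\<And>v. degree (q v) \<le> e"
    using assms unfolding ppoly_def by blast
  then have "\<forall>v. degree (p v + q v) \<le> max d e"
    by (meson degree_add_le le_max_iff_disj order_trans)
  then show ?thesis using assms unfolding ppoly_def by (auto intro: polyfun_add)
qed

lemma ppoly_mult: assumes "ppoly p" "ppoly q" shows "ppoly (\<lambda>v. p v * q v)"
proof -
  obtain d e where "\<And>v. degree (p v) \<le> d" "\<And>v. degree (q v) \<le> e"
    using assms unfolding ppoly_def by blast
  then have "\<forall>v. degree (p v * q v) \<le> d + e"
    by (meson add_mono degree_mult_le order_trans)
  then show ?thesis using assms unfolding ppoly_def
    by (auto simp: coeff_mult intro!: polyfun_sum polyfun_mult)
qed

lemma ppoly_smult: "polyfun c \<Longrightarrow> ppoly p \<Longrightarrow> ppoly (\<lambda>v. smult (c v) (p v))"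
  by (drule ppoly_const, drule (1) ppoly_mult) simp

lemma ppoly_diff: "ppoly p \<Longrightarrow> ppoly q \<Longrightarrow> ppoly (\<lambda>v. p v - q v)"
  by (drule ppoly_smult[OF polyfun_const[of "-1"], of q], drule (1) ppoly_add) simp

lemma ppoly_sum: "(\<And>i. i \<in> I \<Longrightarrow> ppoly (p i)) \<Longrightarrow> ppoly (\<lambda>v. \<Sum>i\<in>I. p i v)"
proof (induction I rule: infinite_finite_induct)
  case (insert x F) then show ?case by (auto intro: ppoly_add)
qed (use ppoly_const[OF polyfun_const, of 0] in auto)

lemma ppoly_power: "ppoly p \<Longrightarrow> ppoly (\<lambda>v. p v ^ k)"
proof (induction k)
  case 0 then show ?case using ppoly_const[OF polyfun_const, of 1] by (simp add: one_pCons)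
qed (auto intro: ppoly_mult)

lemma ppoly_pderiv: assumes "ppoly p" shows "ppoly (\<lambda>v. pderiv (p v))"
proof -
  obtain d where d: "\<And>v. degree (p v) \<le> d" using assms unfolding ppoly_def by blast
  then have "\<forall>v. degree (pderiv (p v)) \<le> d"
    by (metis degree_pderiv diff_le_self le_trans)
  then show ?thesis using assms unfolding ppoly_def
    by (auto simp: coeff_pderiv intro!: polyfun_mult polyfun_const)
qed

lemma poly_eq_sum_le:
  fixes p :: "real poly"
  assumes "degree p \<le> d" shows "poly p x = (\<Sum>i\<le>d. coeff p i * x ^ i)"
  by (subst poly_as_sum_of_monoms'[OF assms, symmetric]) (simp add: poly_sum poly_monom)

text \<open>The degree bound is uniform in the parameters, so the composition is a sum of fixed
  length and the earlier closure properties apply.\<close>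

lemma ppoly_pcompose: assumes "ppoly p" "ppoly q" shows "ppoly (\<lambda>v. pcompose (p v) (q v))"
proof -
  obtain d where d: "\<And>v. degree (p v) \<le> d" using assms unfolding ppoly_def by blast
  have "pcompose (p v) (q v) = (\<Sum>i\<le>d. smult (coeff (p v) i) (q v ^ i))" for v
    by (subst poly_eq_poly_eq_iff[symmetric])
       (simp add: fun_eq_iff poly_pcompose poly_sum poly_eq_sum_le[OF d])
  then show ?thesis using assms unfolding ppoly_def[of p]
    by (auto intro!: ppoly_sum ppoly_smult ppoly_power)
qed

lemma polyfun_poly: assumes "ppoly p" "polyfun c" shows "polyfun (\<lambda>v. poly (p v) (c v))"
proof -
  obtain d where d: "\<And>v. degree (p v) \<le> d" using assms unfolding ppoly_def by blast
  have "poly (p v) (c v) = (\<Sum>i\<le>d. coeff (p v) i * c v ^ i)" for v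
    by (rule poly_eq_sum_le[OF d])
  then show ?thesis using assms unfolding ppoly_def[of p]
    by (auto intro!: polyfun_intros)
qed

lemma ppoly_reindex: "ppoly p \<Longrightarrow> ppoly (\<lambda>v. p (v \<circ> h))"
  unfolding ppoly_def
  by (elim conjE exE, intro conjI allI) (blast, drule spec, erule polyfun_reindex)

section \<open>Effective functions and their substitution for the front variable\<close>

lemma polyfun_Cons_ppoly:
  assumes "polyfun P"
  shows "\<exists>p. ppoly p \<and> (\<forall>v x. P (case_nat x v) = poly (p v) x)"
  using assms
proof (induction rule: polyfun.induct)
  case (polyfun_const c)
  then show ?case using ppoly_const[OF polyfun.polyfun_const[of c]] by fastforce
next
  case (polyfun_var i)
  show ?case
  proof (cases i)
    case 0
    then show ?thesis using ppoly_monom[OF polyfun.polyfun_const[of 1], of 1]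
      by (intro exI[of _ "\<lambda>v. monom 1 1"]) (auto simp: poly_monom)
  next
    case (Suc j)
    then show ?thesis using ppoly_const[OF polyfun.polyfun_var[of j]] by fastforce
  qed
next
  case (polyfun_add P Q)
  then obtain p q where "ppoly p" "ppoly q" "\<forall>v x. P (case_nat x v) = poly (p v) x"
    "\<forall>v x. Q (case_nat x v) = poly (q v) x" by blast
  then show ?case by (intro exI[of _ "\<lambda>v. p v + q v"]) (auto intro: ppoly_add)
next
  case (polyfun_mult P Q)
  then obtain p q where "ppoly p" "ppoly q" "\<forall>v x. P (case_nat x v) = poly (p v) x"
    "\<forall>v x. Q (case_nat x v) = poly (q v) x" by blast
  then show ?case by (intro exI[of _ "\<lambda>v. p v * q v"]) (auto intro: ppoly_mult)
qed

text \<open>Reindexing by \<open>h\<close> provides the spare variables that are needed to substitute one effective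
  function after another.\<close>

definition effective :: "((nat \<Rightarrow> real) \<Rightarrow> real) \<Rightarrow> bool" where
  "effective e \<longleftrightarrow> (\<forall>h q. ppoly q \<longrightarrow> semialg (\<lambda>v. 0 < poly (q v) (e (v \<circ> h))))"

lemma effective_reindex: "effective e \<Longrightarrow> effective (\<lambda>v. e (v \<circ> h))"
  unfolding effective_def by (simp add: comp_assoc)

lemma effectiveD: "effective e \<Longrightarrow> ppoly q \<Longrightarrow> semialg (\<lambda>v. 0 < poly (q v) (e v))"
  unfolding effective_def by (drule spec[of _ id]) simp

text \<open>In an atom the front variable becomes the indeterminate of a \<open>ppoly\<close>, whose
  sign at \<open>e\<close> is semialgebraic by effectiveness; Boolean combinations follow. This is
  how a sample point later replaces a bound variable.\<close>

lemma semialg_subst: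
  assumes "effective e" "semialg A"
  shows "semialg (\<lambda>v. A (case_nat (e v) v))"
  using assms(2)
proof (induction rule: semialg.induct)
  case (semialg_pos P)
  then obtain p where "ppoly p" "\<forall>v x. P (case_nat x v) = poly (p v) x"
    using polyfun_Cons_ppoly by blast
  then show ?case using effectiveD[OF assms(1)] by simp
qed (auto intro: semialg.intros)

lemma case_nat_comp_Suc: "case_nat x v \<circ> Suc = v"
  by auto

lemma effective_less:
  assumes "effective a" "effective b" shows "semialg (\<lambda>v. a v < b v)"
proof -
  \<comment> \<open>Variable 0 is a spare one: \<open>b\<close> is treated first, with its arguments
    shifted by \<open>Suc\<close>, and then \<open>a\<close> is substituted for variable 0.\<close>
  have "semialg (\<lambda>v. 0 < poly (monom 1 1 - [:v 0:]) (b (v \<circ> Suc)))"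
    by (intro effectiveD[OF effective_reindex[OF assms(2)]] ppoly_diff ppoly_monom ppoly_const polyfun_intros)
  from semialg_subst[OF assms(1) this] show ?thesis
    by (simp add: poly_monom case_nat_comp_Suc)
qed

text \<open>With \<open>a = b\<close> and \<open>c\<close> equal to 1 or -1 this also yields
  translates, so that one construction provides all sample points.\<close>

lemma effective_midpoint:
  assumes "effective a" "effective b" shows "effective (\<lambda>v. (a v + b v) / 2 + c)"
proof -
  have *: "semialg (\<lambda>v. 0 < poly (q v) ((a v + b v) / 2 + c))" if "effective a" "effective b" "ppoly q" for a b q
  proof -
    \<comment> \<open>The value of \<open>a\<close> is kept in variable 0. Composition with an
      affine polynomial turns the sign of \<open>q\<close> at the midpoint into the sign of
      \<open>?q\<close> at \<open>b\<close>.\<close>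
    let ?q = "\<lambda>v. pcompose (q (v \<circ> Suc)) (monom (1/2) 1 + [:1/2 * v 0 + c:])"
    have "ppoly ?q"
      by (intro ppoly_pcompose ppoly_add ppoly_monom ppoly_const polyfun_intros
          ppoly_reindex[OF that(3)])
    from effectiveD[OF effective_reindex[OF \<open>effective b\<close>] this]
    have "semialg (\<lambda>v. 0 < poly (?q v) (b (v \<circ> Suc)))" .
    from semialg_subst[OF \<open>effective a\<close> this] show ?thesis
      by (simp add: poly_monom poly_pcompose case_nat_comp_Suc add_divide_distrib ac_simps)
  qed
  show ?thesis unfolding effective_def
    by (intro allI impI, rule *) (rule effective_reindex, rule assms, rule effective_reindex, rule assms)
qed

lemma effective_divide:
  assumes "polyfun N" "polyfun D" shows "effective (\<lambda>v. N v / D v)"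
proof -
  have *: "semialg (\<lambda>v. 0 < poly (q v) (N v / D v))" if "polyfun N" "polyfun D" and q: "ppoly q" for N D q
  proof -
    obtain d where d: "\<And>v. degree (q v) \<le> d" using q unfolding ppoly_def by blast
    \<comment> \<open>One factor \<open>D v ^ d\<close> clears the denominators; the second makes
      the total exponent even, so that the sign of the value of \<open>q\<close> is kept.\<close>
    define R where "R v = D v ^ d * (\<Sum>i\<le>d. coeff (q v) i * N v ^ i * D v ^ (d - i))" for v
    have R: "R v = D v ^ (2 * d) * poly (q v) (N v / D v)" if "D v \<noteq> 0" for v
    proof -
      have "poly (q v) (N v / D v) = (\<Sum>i\<le>d. coeff (q v) i * (N v / D v) ^ i)"
        by (rule poly_eq_sum_le[OF d])
      then have "D v ^ d * poly (q v) (N v / D v) = (\<Sum>i\<le>d. coeff (q v) i * N v ^ i * D v ^ (d - i))"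
        using that by (auto simp: sum_distrib_left power_divide power_diff intro!: sum.cong)
      then show ?thesis by (simp add: R_def mult_2 power_add)
    qed
    \<comment> \<open>Division by zero gives 0, so the degenerate case asks for the sign at 0. The
      square of \<open>D v\<close> distinguishes the two cases.\<close>
    have "0 < poly (q v) (N v / D v) \<longleftrightarrow>
        (D v * D v \<le> 0 \<and> 0 < poly (q v) 0) \<or> 0 < D v * D v \<and> 0 < R v" for v
      by (cases "D v = 0") (auto simp: R zero_less_mult_iff power_mult not_less mult_le_0_iff)
    moreover have "polyfun R" unfolding R_def[abs_def] using q that unfolding ppoly_def
      by (intro polyfun_intros) auto
    then have "semialg (\<lambda>v. (\<not> (0 < D v * D v) \<and> 0 < poly (q v) 0) \<or> 0 < D v * D v \<and> 0 < R v)"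
      by (intro semialg_disj semialg_conj semialg_not semialg_pos polyfun_poly polyfun_intros that)
    ultimately show ?thesis by (simp add: not_less)
  qed
  show ?thesis unfolding effective_def by (intro allI impI, rule *) (rule polyfun_reindex, rule assms, rule polyfun_reindex, rule assms)
qed

lemma effective_polyfun: "polyfun P \<Longrightarrow> effective P"
  using effective_divide[of P "\<lambda>v. 1"] polyfun_const[of 1] by simp

lemma effective_sign:
  assumes "effective a" "ppoly q"
  shows "semialg (\<lambda>v. poly (q v) (a v) < 0)" "semialg (\<lambda>v. poly (q v) (a v) = 0)"
proof -
  have "ppoly (\<lambda>v. smult (-1) (q v))" by (intro ppoly_smult polyfun_const assms)
  from effectiveD[OF assms(1) this] show *: "semialg (\<lambda>v. poly (q v) (a v) < 0)" by simp
  have "poly (q v) (a v) = 0 \<longleftrightarrow> \<not> (0 < poly (q v) (a v) \<or> poly (q v) (a v) < 0)" for v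
    by linarith
  then show "semialg (\<lambda>v. poly (q v) (a v) = 0)"
    by (simp only:) (intro semialg_not semialg_disj * effectiveD assms)
qed

lemma effective_sign_mult:
  assumes "effective a" "effective b" "ppoly q"
  shows "semialg (\<lambda>v. 0 < poly (q v) (a v) * poly (q v) (b v))"
    and "semialg (\<lambda>v. poly (q v) (a v) * poly (q v) (b v) < 0)"
  unfolding zero_less_mult_iff mult_less_0_iff
  by (intro semialg_disj semialg_conj effectiveD effective_sign assms)+

lemma semialg_eff_le: "effective a \<Longrightarrow> effective b \<Longrightarrow> semialg (\<lambda>v. a v \<le> b v)"
  using semialg_not[OF effective_less, of b a] by (simp add: not_less)

section \<open>Real polynomials in one variable: signs, root bounds and pseudo-division\<close>

lemma poly_same_sign:
  fixes f :: "real poly"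
  assumes "\<And>z. min x y \<le> z \<Longrightarrow> z \<le> max x y \<Longrightarrow> poly f z \<noteq> 0"
  shows "0 < poly f x * poly f y"
proof (rule ccontr)
  assume "\<not> ?thesis"
  moreover have "poly f x \<noteq> 0" "poly f y \<noteq> 0" using assms[of x] assms[of y] by auto
  ultimately have neg: "poly f x * poly f y < 0"
    by (meson linorder_neqE_linordered_idom mult_eq_0_iff)
  then have "x \<noteq> y" by (auto simp: mult_less_0_iff)
  then consider "x < y" | "y < x" by linarith
  then show False
  proof cases
    case 1
    from poly_IVT[OF 1 neg] show False using assms by (auto simp: min_def max_def)
  next
    case 2
    from poly_IVT[OF 2, of f] neg show False
      using assms by (auto simp: min_def max_def mult.commute)
  qed
qed

lemma poly_unique_zero:
  fixes f :: "real poly"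
  assumes "\<And>z. s < z \<Longrightarrow> z < t \<Longrightarrow> poly (pderiv f) z \<noteq> 0"
    and "s \<le> x" "x \<le> t" "s \<le> y" "y \<le> t" "poly f x = 0" "poly f y = 0"
  shows "x = y"
proof (rule ccontr)
  assume "x \<noteq> y"
  then consider "x < y" | "y < x" by linarith
  then show False
  proof cases
    case 1 then show False using poly_MVT[OF 1, of f] assms by force
  next
    case 2 then show False using poly_MVT[OF 2, of f] assms by force
  qed
qed

text \<open>By Rolle's argument \<open>y\<close> is the only root in the interval, so on each side
  of it \<open>f\<close> has the sign of the adjacent endpoint, and these two signs are opposite.
  Thus a root is compared with known points without being evaluated.\<close>

lemma poly_monotone_branch:
  fixes f :: "real poly"
  assumes "\<And>z. s < z \<Longrightarrow> z < t \<Longrightarrow> poly (pderiv f) z \<noteq> 0"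
    and "s < t" "poly f s * poly f t < 0" "s < y" "y < t" "poly f y = 0" "s \<le> x" "x \<le> t"
  shows "x < y \<longleftrightarrow> 0 < poly f x * poly f s" "y < x \<longleftrightarrow> 0 < poly f x * poly f t"
proof -
  have uniq: "z = y" if "s \<le> z" "z \<le> t" "poly f z = 0" for z
    using poly_unique_zero[OF assms(1)] that assms by auto
  have l: "0 < poly f x * poly f s" if "x < y"
  proof (rule poly_same_sign)
    fix z assume "min x s \<le> z" "z \<le> max x s"
    then have "s \<le> z" "z \<le> t" "z \<noteq> y" using that assms by linarith+
    then show "poly f z \<noteq> 0" using uniq by blast
  qed
  have r: "0 < poly f x * poly f t" if "y < x"
  proof (rule poly_same_sign)
    fix z assume "min x t \<le> z" "z \<le> max x t"
    then have "s \<le> z" "z \<le> t" "z \<noteq> y" using that assms by linarith+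
    then show "poly f z \<noteq> 0" using uniq by blast
  qed
  show "x < y \<longleftrightarrow> 0 < poly f x * poly f s" "y < x \<longleftrightarrow> 0 < poly f x * poly f t"
    using l r assms by (cases x y rule: linorder_cases; force simp: zero_less_mult_iff mult_less_0_iff)+
qed

text \<open>Squares replace the absolute values of Cauchy's root bound, at the cost of the estimate
  |u| <= 1 + u^2. The bound is then a quotient of polynomials in the coefficients, hence
  effective.\<close>

lemma poly_cauchy_bound:
  fixes f :: "real poly"
  assumes "degree f \<le> Suc d" "coeff f (Suc d) = a" "a \<noteq> 0" "poly f x = 0"
  shows "\<bar>x\<bar> < (a ^ 2 * (real d + 2) + (\<Sum>j\<le>d. coeff f j ^ 2)) / a ^ 2"
proof (rule ccontr)
  define u where "u j = coeff f j / a" for j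
  \<comment> \<open>The \<open>d + 1\<close> summands 1 + u^2 add up to \<open>B - 1\<close>,
    strictly less than \<open>B\<close>; moreover \<open>B\<close> is at least 2, so powers of
    \<bar>x\<bar> increase with the exponent.\<close>
  define B where "B = (real d + 2) + (\<Sum>j\<le>d. u j ^ 2)"
  have "(a ^ 2 * (real d + 2) + (\<Sum>j\<le>d. coeff f j ^ 2)) / a ^ 2 = B"
    using assms(3) by (simp add: B_def u_def add_divide_distrib sum_divide_distrib power_divide)
  moreover assume "\<not> ?thesis"
  ultimately have x: "\<bar>x\<bar> \<ge> B" by simp
  have B2: "B \<ge> 2" unfolding B_def by (simp add: sum_nonneg add_increasing2)
  have "0 = poly f x" using assms by simp
  also have "\<dots> = a * x ^ Suc d + (\<Sum>j\<le>d. coeff f j * x ^ j)"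
    using poly_eq_sum_le[OF assms(1)] assms(2) by simp
  finally have "x ^ Suc d = - (\<Sum>j\<le>d. u j * x ^ j)"
    using assms(3) by (simp add: u_def sum_divide_distrib[symmetric] field_simps)
  then have "\<bar>x\<bar> ^ Suc d = \<bar>\<Sum>j\<le>d. u j * x ^ j\<bar>" by (metis abs_minus_cancel power_abs)
  also have "\<dots> \<le> (\<Sum>j\<le>d. \<bar>u j * x ^ j\<bar>)" by (rule sum_abs)
  also have "\<dots> \<le> (\<Sum>j\<le>d. (1 + u j ^ 2) * \<bar>x\<bar> ^ d)"
  proof (rule sum_mono)
    fix j assume "j \<in> {..d}"
    have "\<bar>u j\<bar> \<le> 1 + u j ^ 2"
      using zero_le_power2[of "\<bar>u j\<bar> - 1"] by (simp add: power2_eq_square algebra_simps)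
    moreover have "\<bar>x\<bar> ^ j \<le> \<bar>x\<bar> ^ d"
      using x B2 \<open>j \<in> {..d}\<close> by (intro power_increasing) auto
    ultimately show "\<bar>u j * x ^ j\<bar> \<le> (1 + u j ^ 2) * \<bar>x\<bar> ^ d"
      by (simp add: abs_mult power_abs mult_mono)
  qed
  also have "\<dots> = (B - 1) * \<bar>x\<bar> ^ d"
    by (simp add: B_def sum_distrib_right[symmetric] sum.distrib)
  also have "\<dots> < \<bar>x\<bar> * \<bar>x\<bar> ^ d"
    using x B2 by (intro mult_strict_right_mono) auto
  finally show False by simp
qed

text \<open>Pseudo-division by \<open>p\<close>: a multiplier that is a square keeps the sign at the roots of \<open>p\<close>.\<close>

lemma ppoly_reduce:
  assumes p: "ppoly p" "\<And>v. degree (p v) \<le> Suc d" and q: "ppoly q"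
  shows "\<exists>r. ppoly r \<and> (\<forall>v. degree (r v) \<le> d) \<and> (\<forall>v x. coeff (p v) (Suc d) \<noteq> 0 \<longrightarrow>
    poly (p v) x = 0 \<longrightarrow> (0 < poly (r v) x \<longleftrightarrow> 0 < poly (q v) x))"
proof -
  obtain n where "\<And>v. degree (q v) \<le> n" using q unfolding ppoly_def by blast
  then show ?thesis using q
  proof (induction n arbitrary: q)
    case 0
    then show ?case by (intro exI[of _ q]) auto
  next
    case (Suc n)
    show ?case
    proof (cases "Suc n \<le> d")
      case True
      then show ?thesis using Suc.prems by (intro exI[of _ q]) (auto intro: order_trans)
    next
      case False
      let ?a = "\<lambda>v. coeff (p v) (Suc d)" and ?b = "\<lambda>v. coeff (q v) (Suc n)"
      \<comment> \<open>The terms of degree \<open>Suc n\<close> cancel, and at a root of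
        \<open>p v\<close> only the square of \<open>?a v\<close> times \<open>q v\<close> is
        left.\<close>
      define q' where "q' v = smult (?a v * ?a v) (q v) - smult (?a v * ?b v) (monom 1 (n - d) * p v)" for v
      have deg: "degree (q' v) \<le> n" for v
      proof (rule degree_le, intro allI impI)
        fix i assume i: "n < i"
        show "coeff (q' v) i = 0"
        proof (cases "i = Suc n")
          case True
          then show ?thesis using False by (simp add: q'_def coeff_monom_mult Suc_diff_le)
        next
          case False
          then have "degree (q v) < i" "degree (p v) < i - (n - d)"
            using i p(2)[of v] Suc.prems(1)[of v] \<open>\<not> Suc n \<le> d\<close> by auto
          then show ?thesis by (simp add: q'_def coeff_monom_mult coeff_eq_0)
        qed
      qed
      have polyf: "polyfun ?a" "polyfun ?b" using p Suc.prems unfolding ppoly_def by auto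
      have "ppoly q'" unfolding q'_def[abs_def]
        by (intro ppoly_diff ppoly_smult ppoly_mult ppoly_monom polyfun_intros polyf p Suc.prems)
      from Suc.IH[OF deg this] obtain r where r: "ppoly r" "\<forall>v. degree (r v) \<le> d"
        "\<forall>v x. ?a v \<noteq> 0 \<longrightarrow> poly (p v) x = 0 \<longrightarrow> (0 < poly (r v) x \<longleftrightarrow> 0 < poly (q' v) x)"
        by blast
      moreover have "0 < poly (q' v) x \<longleftrightarrow> 0 < poly (q v) x" if "?a v \<noteq> 0" "poly (p v) x = 0" for v x
        using that by (auto simp: q'_def zero_less_mult_iff linorder_neq_iff)
      ultimately show ?thesis by blast
    qed
  qed
qed

section \<open>Covering the roots by effective functions\<close>

definition root_cover :: "((nat \<Rightarrow> real) \<Rightarrow> real) set \<Rightarrow> ((nat \<Rightarrow> real) \<Rightarrow> real poly) \<Rightarrow> bool" where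
  "root_cover H p \<longleftrightarrow> finite H \<and> (\<forall>h\<in>H. effective h) \<and>
     (\<forall>v x. p v \<noteq> 0 \<longrightarrow> poly (p v) x = 0 \<longrightarrow> (\<exists>h\<in>H. h v = x))"

text \<open>Here \<open>\<xi>\<close> is the only root of \<open>p\<close> between \<open>s\<close> and \<open>t\<close>. Its position relative to a root of the
  reduced polynomial \<open>r\<close> is read off the sign of \<open>p\<close>, and \<open>r (\<xi>)\<close> has the sign of \<open>r\<close> at the midpoint of
  the two neighbouring roots of \<open>r\<close>.\<close>

lemma semialg_branch_sign:
  assumes IH: "\<And>r. ppoly r \<Longrightarrow> (\<And>v. degree (r v) \<le> d) \<Longrightarrow> \<exists>H. root_cover H r"
    and p: "ppoly p" "\<And>v. degree (p v) \<le> Suc d"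
    and "effective s" "effective t" "semialg C" "ppoly q"
    and lead: "\<And>v. C v \<Longrightarrow> coeff (p v) (Suc d) \<noteq> 0"
    and root: "\<And>v. C v \<Longrightarrow> s v < \<xi> v \<and> \<xi> v < t v \<and> poly (p v) (\<xi> v) = 0"
    and left: "\<And>v x. C v \<Longrightarrow> s v \<le> x \<Longrightarrow> x \<le> t v \<Longrightarrow>
      (x < \<xi> v \<longleftrightarrow> 0 < poly (p v) x * poly (p v) (s v))"
    and right: "\<And>v x. C v \<Longrightarrow> s v \<le> x \<Longrightarrow> x \<le> t v \<Longrightarrow>
      (\<xi> v < x \<longleftrightarrow> 0 < poly (p v) x * poly (p v) (t v))"
  shows "semialg (\<lambda>v. C v \<and> 0 < poly (q v) (\<xi> v))"
proof -
  obtain r where r: "ppoly r" "\<And>v. degree (r v) \<le> d"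
    and rq: "\<And>v x. coeff (p v) (Suc d) \<noteq> 0 \<Longrightarrow> poly (p v) x = 0 \<Longrightarrow>
      (0 < poly (r v) x \<longleftrightarrow> 0 < poly (q v) x)"
    using ppoly_reduce[OF p \<open>ppoly q\<close>] by blast
  obtain H where H: "finite H" "\<And>h. h \<in> H \<Longrightarrow> effective h"
    "\<And>v x. r v \<noteq> 0 \<Longrightarrow> poly (r v) x = 0 \<Longrightarrow> (\<exists>h\<in>H. h v = x)"
    using IH[OF r] unfolding root_cover_def by blast
  define E where "E = insert s (insert t H)"
  have E: "finite E" "\<And>e. e \<in> E \<Longrightarrow> effective e" using H assms(4,5) by (auto simp: E_def)
  \<comment> \<open>The signs of \<open>p\<close> place \<open>a\<close> to the left and
    \<open>b\<close> to the right of the root; no root of \<open>r\<close> lies strictly between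
    them. The summand 0 fits the form of \<open>effective_midpoint\<close>.\<close>
  define \<Phi> where "\<Phi> v a b \<longleftrightarrow> s v \<le> a v \<and> a v \<le> t v \<and> s v \<le> b v \<and> b v \<le> t v \<and>
     0 < poly (p v) (a v) * poly (p v) (s v) \<and> 0 < poly (p v) (b v) * poly (p v) (t v) \<and>
     (\<forall>h\<in>H. \<not> (a v < h v \<and> h v < b v \<and> poly (r v) (h v) = 0)) \<and>
     0 < poly (r v) ((a v + b v) / 2 + 0)" for v and a b :: "(nat \<Rightarrow> real) \<Rightarrow> real"
  have "0 < poly (q v) (\<xi> v) \<longleftrightarrow> (\<exists>a\<in>E. \<exists>b\<in>E. \<Phi> v a b)" if C: "C v" for v
  proof -
    note xi = root[OF C]
    have "0 < poly (q v) (\<xi> v) \<longleftrightarrow> 0 < poly (r v) (\<xi> v)"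
      using rq lead[OF C] xi by blast
    also have "\<dots> \<longleftrightarrow> (\<exists>a\<in>E. \<exists>b\<in>E. \<Phi> v a b)"
    proof
      assume "\<exists>a\<in>E. \<exists>b\<in>E. \<Phi> v a b"
      then obtain a b where ab: "a \<in> E" "b \<in> E" "\<Phi> v a b" by blast
      then have lr: "a v < \<xi> v" "\<xi> v < b v" using left[OF C] right[OF C] unfolding \<Phi>_def by blast+
      \<comment> \<open>Positivity also excludes that \<open>r v\<close> is the zero polynomial,
        about which the cover \<open>H\<close> says nothing.\<close>
      have pos: "0 < poly (r v) ((a v + b v) / 2)" using ab unfolding \<Phi>_def by simp
      have "0 < poly (r v) (\<xi> v) * poly (r v) ((a v + b v) / 2)"
      proof (rule poly_same_sign)
        fix z assume "min (\<xi> v) ((a v + b v) / 2) \<le> z" "z \<le> max (\<xi> v) ((a v + b v) / 2)"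
        then have "a v < z" "z < b v" using lr by (auto simp: min_def max_def split: if_splits)
        then show "poly (r v) z \<noteq> 0"
          using ab(3) H(3)[of v z] pos unfolding \<Phi>_def by fastforce
      qed
      with pos show "0 < poly (r v) (\<xi> v)" by (simp add: zero_less_mult_iff)
    next
      assume pos: "0 < poly (r v) (\<xi> v)"
      \<comment> \<open>The maximum of \<open>A\<close> and the minimum of \<open>B\<close> are the
        neighbours of \<open>\<xi> v\<close> among the roots of \<open>r\<close> within the
        interval, with \<open>s v\<close> and \<open>t v\<close> as fallbacks.\<close>
      define A where "A = {x \<in> (\<lambda>e. e v) ` E. s v \<le> x \<and> x < \<xi> v \<and> (x = s v \<or> poly (r v) x = 0)}"
      define B where "B = {x \<in> (\<lambda>e. e v) ` E. \<xi> v < x \<and> x \<le> t v \<and> (x = t v \<or> poly (r v) x = 0)}"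
      have A: "finite A" "s v \<in> A" and B: "finite B" "t v \<in> B"
        using E(1) xi by (auto simp: A_def B_def E_def)
      have "Max A \<in> A" "Min B \<in> B" using A B by (auto intro!: Max_in Min_in)
      then obtain a b where ab: "a \<in> E" "b \<in> E" "a v = Max A" "b v = Min B"
        unfolding A_def B_def by auto
      have lr: "s v \<le> a v" "a v < \<xi> v" "\<xi> v < b v" "b v \<le> t v"
        using \<open>Max A \<in> A\<close> \<open>Min B \<in> B\<close> ab unfolding A_def B_def by auto
      have no: "\<not> (a v < h v \<and> h v < b v \<and> poly (r v) (h v) = 0)" if h: "h \<in> H" for h
      proof
        assume hv: "a v < h v \<and> h v < b v \<and> poly (r v) (h v) = 0"
        then have "h v \<noteq> \<xi> v" using pos by auto
        moreover have "h v \<in> A" if "h v < \<xi> v" using that hv lr h by (auto simp: A_def E_def)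
        moreover have "h v \<in> B" if "\<xi> v < h v" using that hv lr h by (auto simp: B_def E_def)
        ultimately show False
          using Max_ge[OF A(1), of "h v"] Min_le[OF B(1), of "h v"] hv ab by force
      qed
      have "0 < poly (r v) (\<xi> v) * poly (r v) ((a v + b v) / 2)"
      proof (rule poly_same_sign)
        fix z assume "min (\<xi> v) ((a v + b v) / 2) \<le> z" "z \<le> max (\<xi> v) ((a v + b v) / 2)"
        then have "a v < z" "z < b v" using lr by (auto simp: min_def max_def split: if_splits)
        then show "poly (r v) z \<noteq> 0"
          using no H(3)[of v z] pos by fastforce
      qed
      with pos have "0 < poly (r v) ((a v + b v) / 2)" by (simp add: zero_less_mult_iff)
      with no lr left[OF C, of "a v"] right[OF C, of "b v"] have "\<Phi> v a b"
        unfolding \<Phi>_def by auto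
      with ab show "\<exists>a\<in>E. \<exists>b\<in>E. \<Phi> v a b" by blast
    qed
    finally show ?thesis .
  qed
  then have "(\<lambda>v. C v \<and> 0 < poly (q v) (\<xi> v)) = (\<lambda>v. C v \<and> (\<exists>a\<in>E. \<exists>b\<in>E. \<Phi> v a b))"
    by (intro ext conj_cong refl)
  moreover have "semialg (\<lambda>v. \<Phi> v a b)" if "a \<in> E" "b \<in> E" for a b
  proof -
    have e: "effective a" "effective b" using E that by auto
    have "semialg (\<lambda>v. \<forall>h\<in>H. \<not> (a v < h v \<and> h v < b v \<and> poly (r v) (h v) = 0))"
      by (rule semialg_ball[OF H(1)], rule semialg_not, intro semialg_conj)
        (erule effective_less[OF e(1) H(2)] effective_less[OF H(2) e(2)] effective_sign(2)[OF H(2) r(1)])+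
    then show ?thesis
      unfolding \<Phi>_def
      by (intro semialg_conj semialg_eff_le[OF assms(4) e(1)] semialg_eff_le[OF e(1) assms(5)]
          semialg_eff_le[OF assms(4) e(2)] semialg_eff_le[OF e(2) assms(5)]
          effective_sign_mult(1)[OF e(1) assms(4) p(1)] effective_sign_mult(1)[OF e(2) assms(5) p(1)]
          effectiveD[OF effective_midpoint[OF e] r(1)])
  qed
  then have "semialg (\<lambda>v. C v \<and> (\<exists>a\<in>E. \<exists>b\<in>E. \<Phi> v a b))"
    by (intro semialg_conj semialg_bex E assms)
  ultimately show ?thesis by simp
qed

text \<open>If the leading coefficient does not vanish, every root is a critical point or the only root
  between two neighbours among the critical points and the root bounds \<open>B\<close> and \<open>B' = - B\<close>.\<close>

lemma ex_root_cover:
  "ppoly p \<Longrightarrow> (\<And>v. degree (p v) \<le> d) \<Longrightarrow> \<exists>H. root_cover H p"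
proof (induction d arbitrary: p)
  case 0
  have "poly (p v) x \<noteq> 0" if "p v \<noteq> 0" for v x
    using that 0(2)[of v] by (auto elim!: degree_eq_zeroE)
  then show ?case unfolding root_cover_def by (intro exI[of _ "{}"]) auto
next
  case (Suc d)
  let ?a = "\<lambda>v. coeff (p v) (Suc d)"
  have coeffs: "polyfun (\<lambda>v. coeff (p v) j)" for j using Suc.prems(1) unfolding ppoly_def by auto
  \<comment> \<open>Where the leading coefficient vanishes, \<open>p\<close> coincides with this
    truncation, to which the induction hypothesis applies.\<close>
  have deg0: "degree (p v - monom (?a v) (Suc d)) \<le> d" for v
  proof (rule degree_le, intro allI impI)
    fix i assume "d < i"
    then show "coeff (p v - monom (?a v) (Suc d)) i = 0"
      using Suc.prems(2)[of v] by (cases "i = Suc d") (auto intro: coeff_eq_0)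
  qed
  have "ppoly (\<lambda>v. p v - monom (?a v) (Suc d))"
    by (intro ppoly_diff ppoly_monom coeffs Suc.prems)
  from Suc.IH[OF this deg0] obtain H where H: "root_cover H (\<lambda>v. p v - monom (?a v) (Suc d))" ..
  have "degree (pderiv (p v)) \<le> d" for v using Suc.prems(2)[of v] by (simp add: degree_pderiv)
  from Suc.IH[OF ppoly_pderiv[OF Suc.prems(1)] this] obtain T where T: "root_cover T (\<lambda>v. pderiv (p v))" ..
  have pderiv_nz: "pderiv (p v) \<noteq> 0" if "?a v \<noteq> 0" for v
    using that by (metis coeff_0 coeff_pderiv mult_eq_0_iff of_nat_eq_0_iff old.nat.distinct(2))
  define N where "N v = ?a v ^ 2 * (real d + 2) + (\<Sum>j\<le>d. coeff (p v) j ^ 2)" for v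
  define B where "B v = N v / ?a v ^ 2" for v
  define B' where "B' v = (- N v) / ?a v ^ 2" for v
  have "polyfun N" unfolding N_def[abs_def] by (intro polyfun_intros coeffs)
  then have eB: "effective B" "effective B'" unfolding B_def[abs_def] B'_def[abs_def]
    by (intro effective_divide polyfun_intros coeffs; assumption)+
  have bound: "B' v < x \<and> x < B v" if "?a v \<noteq> 0" "poly (p v) x = 0" for v x
  proof -
    have "\<bar>x\<bar> < B v" unfolding B_def N_def by (rule poly_cauchy_bound[OF Suc.prems(2) refl that])
    moreover have "B' v = - B v" by (simp add: B_def B'_def)
    ultimately show ?thesis by (simp add: abs_less_iff)
  qed
  define E where "E = insert B (insert B' T)"
  have E: "finite E" "\<And>e. e \<in> E \<Longrightarrow> effective e" and T': "finite T" "\<And>e. e \<in> T \<Longrightarrow> effective e"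
    using T eB by (auto simp: E_def root_cover_def)
  have crit: "\<exists>h\<in>T. h v = x" if "?a v \<noteq> 0" "poly (pderiv (p v)) x = 0" for v x
    using T pderiv_nz[OF that(1)] that(2) by (auto simp: root_cover_def)
  \<comment> \<open>The sign change gives a root between \<open>s v\<close> and \<open>t v\<close>,
    and the absence of critical points makes it unique.\<close>
  define C where "C s t v \<longleftrightarrow> (?a v < 0 \<or> 0 < ?a v) \<and> s v < t v \<and>
    poly (p v) (s v) * poly (p v) (t v) < 0 \<and> (\<forall>h\<in>T. \<not> (s v < h v \<and> h v < t v))"
    for s t :: "(nat \<Rightarrow> real) \<Rightarrow> real" and v
  \<comment> \<open>Outside \<open>C\<close> the default value 0 keeps the sign of any
    \<open>q\<close> at \<open>\<xi>\<close> a semialgebraic condition.\<close>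
  define \<xi> where "\<xi> s t v = (if C s t v then THE x. s v < x \<and> x < t v \<and> poly (p v) x = 0 else 0)"
    for s t :: "(nat \<Rightarrow> real) \<Rightarrow> real" and v
  have saC: "semialg (C s t)" if "effective s" "effective t" for s t
    unfolding C_def[abs_def]
    by (intro semialg_conj semialg_disj semialg_less semialg_ball semialg_not effective_less effective_sign_mult T' that Suc.prems
        polyfun_const coeffs)
  have no_crit: "poly (pderiv (p v)) z \<noteq> 0" if "C s t v" "s v < z" "z < t v" for s t v z
    using that crit[of v z] unfolding C_def by auto
  have \<xi>_eq: "\<xi> s t v = x" if C: "C s t v" and x: "s v < x" "x < t v" "poly (p v) x = 0" for s t v x
  proof -
    have "y = x" if "s v < y" "y < t v" "poly (p v) y = 0" for y
      by (rule poly_unique_zero[of "s v" "t v"]) (use no_crit[OF C] that x in auto)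
    then have "(THE x. s v < x \<and> x < t v \<and> poly (p v) x = 0) = x"
      by (intro the_equality conjI x) (elim conjE)
    then show ?thesis using C by (simp add: \<xi>_def)
  qed
  have \<xi>: "s v < \<xi> s t v \<and> \<xi> s t v < t v \<and> poly (p v) (\<xi> s t v) = 0" if C: "C s t v" for s t v
  proof -
    obtain x where "s v < x" "x < t v" "poly (p v) x = 0"
      using poly_IVT[of "s v" "t v" "p v"] C unfolding C_def by auto
    with \<xi>_eq[OF C] show ?thesis by metis
  qed
  have eff\<xi>: "effective (\<xi> s t)" if st: "effective s" "effective t" for s t
    unfolding effective_def
  proof (intro allI impI)
    fix h :: "nat \<Rightarrow> nat" and q assume q: "ppoly q"
    have saCh: "semialg (\<lambda>v. C s t (v \<circ> h))" by (rule semialg_reindex[OF saC[OF st]])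
    have 1: "semialg (\<lambda>v. C s t (v \<circ> h) \<and> 0 < poly (q v) (\<xi> s t (v \<circ> h)))"
    proof (rule semialg_branch_sign[OF Suc.IH ppoly_reindex[OF Suc.prems(1)] Suc.prems(2)
          effective_reindex[OF st(1)] effective_reindex[OF st(2)] saCh q])
      fix v x assume C: "C s t (v \<circ> h)"
      show "?a (v \<circ> h) \<noteq> 0" using C by (auto simp: C_def)
      show "s (v \<circ> h) < \<xi> s t (v \<circ> h) \<and> \<xi> s t (v \<circ> h) < t (v \<circ> h) \<and>
        poly (p (v \<circ> h)) (\<xi> s t (v \<circ> h)) = 0" using \<xi>[OF C] .
      have neg: "s (v \<circ> h) < t (v \<circ> h)" "poly (p (v \<circ> h)) (s (v \<circ> h)) * poly (p (v \<circ> h)) (t (v \<circ> h)) < 0"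
        using C by (auto simp: C_def)
      assume "s (v \<circ> h) \<le> x" "x \<le> t (v \<circ> h)"
      with poly_monotone_branch[OF no_crit[OF C] neg _ _ _ this] \<xi>[OF C]
      show "x < \<xi> s t (v \<circ> h) \<longleftrightarrow> 0 < poly (p (v \<circ> h)) x * poly (p (v \<circ> h)) (s (v \<circ> h))"
        "\<xi> s t (v \<circ> h) < x \<longleftrightarrow> 0 < poly (p (v \<circ> h)) x * poly (p (v \<circ> h)) (t (v \<circ> h))"
        by blast+
    qed
    have 2: "semialg (\<lambda>v. \<not> C s t (v \<circ> h) \<and> 0 < poly (q v) 0)"
      by (intro semialg_conj semialg_not saCh semialg_pos polyfun_poly q polyfun_const)
    have "(\<lambda>v. 0 < poly (q v) (\<xi> s t (v \<circ> h))) =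
       (\<lambda>v. (C s t (v \<circ> h) \<and> 0 < poly (q v) (\<xi> s t (v \<circ> h))) \<or> (\<not> C s t (v \<circ> h) \<and> 0 < poly (q v) 0))"
      by (auto simp: fun_eq_iff \<xi>_def)
    then show "semialg (\<lambda>v. 0 < poly (q v) (\<xi> s t (v \<circ> h)))"
      using semialg_disj[OF 1 2] by simp
  qed
  let ?X = "(\<lambda>(s, t). \<xi> s t) ` (E \<times> E)"
  have cover: "\<exists>h\<in>H \<union> T \<union> ?X. h v = x" if nz: "p v \<noteq> 0" and zero: "poly (p v) x = 0" for v x
  proof (cases "?a v = 0")
    case True
    then have "p v - monom (?a v) (Suc d) = p v" by simp
    then show ?thesis using H nz zero unfolding root_cover_def by (metis UnI1)
  next
    case a: False
    show ?thesis
    proof (cases "\<exists>h\<in>T. h v = x")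
      case True
      then show ?thesis by blast
    next
      case False
      define L where "L = {y \<in> (\<lambda>e. e v) ` E. y < x}"
      define U where "U = {y \<in> (\<lambda>e. e v) ` E. x < y}"
      have L: "finite L" "B' v \<in> L" and U: "finite U" "B v \<in> U"
        using E(1) bound[OF a zero] by (auto simp: L_def U_def E_def)
      have "Max L \<in> L" "Min U \<in> U" using L U by (auto intro!: Max_in Min_in)
      then obtain s t where st: "s \<in> E" "t \<in> E" "s v = Max L" "t v = Min U"
        unfolding L_def U_def by auto
      have lr: "s v < x" "x < t v" using \<open>Max L \<in> L\<close> \<open>Min U \<in> U\<close> st unfolding L_def U_def by auto
      have no: "\<not> (s v < h v \<and> h v < t v)" if "h \<in> T" for h
      proof
        assume h: "s v < h v \<and> h v < t v"
        have "h v \<noteq> x" using False that by blast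
        moreover have "h v \<in> L" if "h v < x" using that \<open>h \<in> T\<close> by (auto simp: L_def E_def)
        moreover have "h v \<in> U" if "x < h v" using that \<open>h \<in> T\<close> by (auto simp: U_def E_def)
        ultimately show False
          using Max_ge[OF L(1), of "h v"] Min_le[OF U(1), of "h v"] h st by force
      qed
      have nc: "poly (pderiv (p v)) z \<noteq> 0" if "s v < z" "z < t v" for z
        using crit[OF a, of z] no that by auto
      \<comment> \<open>The mean value theorem on both sides of the root \<open>x\<close> expresses
        the values at \<open>s v\<close> and \<open>t v\<close> by derivatives of equal sign; hence
        these values have opposite signs and \<open>C s t v\<close> holds.\<close>
      obtain \<alpha> where \<alpha>: "s v < \<alpha>" "\<alpha> < x" "poly (p v) x - poly (p v) (s v) = (x - s v) * poly (pderiv (p v)) \<alpha>"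
        using poly_MVT[OF lr(1), of "p v"] by blast
      obtain \<beta> where \<beta>: "x < \<beta>" "\<beta> < t v" "poly (p v) (t v) - poly (p v) x = (t v - x) * poly (pderiv (p v)) \<beta>"
        using poly_MVT[OF lr(2), of "p v"] by blast
      have "0 < poly (pderiv (p v)) \<alpha> * poly (pderiv (p v)) \<beta>"
        by (rule poly_same_sign) (use nc \<alpha> \<beta> in \<open>auto simp: min_def max_def\<close>)
      then have "0 < (x - s v) * (t v - x) * (poly (pderiv (p v)) \<alpha> * poly (pderiv (p v)) \<beta>)"
        using lr by simp
      also have "\<dots> = - (poly (p v) (s v) * poly (p v) (t v))"
      proof -
        have "poly (p v) (s v) = - ((x - s v) * poly (pderiv (p v)) \<alpha>)"
          "poly (p v) (t v) = (t v - x) * poly (pderiv (p v)) \<beta>"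
          using \<alpha>(3) \<beta>(3) zero by auto
        then show ?thesis by (simp only: mult_ac minus_mult_left minus_minus)
      qed
      finally have "C s t v" using a lr no by (auto simp: C_def)
      from \<xi>_eq[OF this lr zero] show ?thesis using st by force
    qed
  qed
  have "finite (H \<union> T \<union> ?X)" "\<forall>h\<in>H \<union> T \<union> ?X. effective h"
    using H T' E eff\<xi> by (auto simp: root_cover_def)
  then show ?case unfolding root_cover_def
    by (intro exI[of _ "H \<union> T \<union> ?X"] conjI allI impI cover)
qed

section \<open>Sample points and elimination of a quantifier\<close>

lemma ex_root_cover_finite:
  assumes "finite F" "\<forall>p\<in>F. ppoly p"
  obtains H where "finite H" "\<And>h. h \<in> H \<Longrightarrow> effective h"
    "\<And>p v x. p \<in> F \<Longrightarrow> p v \<noteq> 0 \<Longrightarrow> poly (p v) x = 0 \<Longrightarrow> \<exists>h\<in>H. h v = x"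
proof -
  have "\<forall>p\<in>F. \<exists>H. root_cover H p" using ex_root_cover assms(2) unfolding ppoly_def by meson
  then obtain H where H: "\<And>p. p \<in> F \<Longrightarrow> root_cover (H p) p" by metis
  show ?thesis
  proof (rule that[of "\<Union>(H ` F)"])
    show "\<exists>h\<in>\<Union>(H ` F). h v = x" if "p \<in> F" "p v \<noteq> 0" "poly (p v) x = 0" for p v x
      using H[OF that(1)] that unfolding root_cover_def by (meson UN_I)
  qed (use H assms(1) in \<open>auto simp: root_cover_def\<close>)
qed

text \<open>The values of the covering functions cut the line into points and open intervals on
  which no sign changes. The sample for \<open>x\<close> is \<open>x\<close> itself if it is a cut
  point, else a midpoint of two neighbouring cut points or, on an unbounded interval, the outermost
  cut point moved by 1.\<close>

lemma ex_sample_points: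
  assumes F: "finite F" "\<forall>p\<in>F. ppoly p"
  shows "\<exists>\<Xi>. finite \<Xi> \<and> (\<forall>e\<in>\<Xi>. effective e) \<and>
    (\<forall>v x. \<exists>e\<in>\<Xi>. \<forall>p\<in>F. sgn (poly (p v) x) = sgn (poly (p v) (e v)))"
proof (rule ex_root_cover_finite[OF F])
  fix H0 assume H0: "finite H0" "\<And>h. h \<in> H0 \<Longrightarrow> effective h"
    "\<And>p v x. p \<in> F \<Longrightarrow> p v \<noteq> 0 \<Longrightarrow> poly (p v) x = 0 \<Longrightarrow> \<exists>h\<in>H0. h v = x"
  \<comment> \<open>The additional cut point 0 ensures that there is at least one.\<close>
  define H where "H = insert (\<lambda>v. 0) H0"
  have H: "finite H" "H \<noteq> {}" "\<And>h. h \<in> H \<Longrightarrow> effective h"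
    using H0(1,2) effective_polyfun[OF polyfun_const] by (auto simp: H_def)
  have HV: "x \<in> (\<lambda>h. h v) ` H" if "p \<in> F" "p v \<noteq> 0" "poly (p v) x = 0" for p v x
    using H0(3)[OF that] by (auto simp: H_def)
  define pt :: "((nat \<Rightarrow> real) \<Rightarrow> real) \<Rightarrow> ((nat \<Rightarrow> real) \<Rightarrow> real) \<Rightarrow> real \<Rightarrow> (nat \<Rightarrow> real) \<Rightarrow> real"
    where "pt a b c v = (a v + b v) / 2 + c" for a b c v
  define \<Xi> where "\<Xi> = (\<lambda>(a, b, c). pt a b c) ` (H \<times> H \<times> {-1, 0, 1})"
  have effpt: "effective (pt a b c)" if "a \<in> H" "b \<in> H" for a b c
    unfolding pt_def[abs_def] by (intro effective_midpoint H(3) that)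
  have "finite \<Xi>" "\<forall>e\<in>\<Xi>. effective e"
    using H(1) effpt unfolding \<Xi>_def by auto
  moreover have pt: "pt a b c \<in> \<Xi>" if "a \<in> H" "b \<in> H" "c \<in> {-1, 0, 1}" for a b c
    unfolding \<Xi>_def using that by force
  have "\<exists>e\<in>\<Xi>. \<forall>p\<in>F. sgn (poly (p v) x) = sgn (poly (p v) (e v))" for v x
  proof -
    let ?V = "(\<lambda>h. h v) ` H"
    have free: ?thesis if e: "e \<in> \<Xi>"
      and gap: "\<And>z. z \<in> ?V \<Longrightarrow> \<not> (min x (e v) \<le> z \<and> z \<le> max x (e v))" for e
    proof (intro bexI[OF _ e] ballI)
      fix p assume p: "p \<in> F"
      show "sgn (poly (p v) x) = sgn (poly (p v) (e v))"
      proof (cases "p v = 0")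
        case False
        have "0 < poly (p v) x * poly (p v) (e v)"
          by (rule poly_same_sign) (use HV[OF p False] gap in blast)
        then show ?thesis by (auto simp: zero_less_mult_iff)
      qed simp
    qed
    define L where "L = {y \<in> ?V. y < x}"
    define U where "U = {y \<in> ?V. x < y}"
    have fin: "finite L" "finite U" using H by (auto simp: L_def U_def)
    have LD: "y \<le> Max L" if "y \<in> ?V" "y < x" for y using that fin by (auto simp: L_def)
    have UD: "Min U \<le> y" if "y \<in> ?V" "x < y" for y using that fin by (auto simp: U_def)
    have Lin: "\<exists>a\<in>H. a v = Max L \<and> a v < x" if "L \<noteq> {}"
      using Max_in[OF fin(1) that] unfolding L_def by auto
    have Uin: "\<exists>a\<in>H. a v = Min U \<and> x < a v" if "U \<noteq> {}"
      using Min_in[OF fin(2) that] unfolding U_def by auto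
    show ?thesis
    proof (cases "x \<in> ?V")
      case True
      then obtain a where "a \<in> H" "a v = x" by blast
      then show ?thesis using pt[of a a 0] by (intro bexI[of _ "pt a a 0"]) (auto simp: pt_def)
    next
      case x: False
      obtain a where a: "a v \<in> ?V" using H(2) by blast
      then have "a v < x \<or> x < a v" using x by (metis linorder_neqE_linordered_idom)
      then have "a v \<in> L \<or> a v \<in> U" using a by (simp add: L_def U_def)
      then consider "L \<noteq> {}" "U \<noteq> {}" | "L \<noteq> {}" "U = {}" | "L = {}" "U \<noteq> {}"
        by blast
      then show ?thesis
      proof cases
        case 1
        then obtain a b where ab: "a \<in> H" "a v = Max L" "a v < x" "b \<in> H" "b v = Min U" "x < b v"
          using Lin Uin by blast
        show ?thesis
        proof (rule free[OF pt[of a b 0]])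
          fix z assume "z \<in> ?V"
          moreover from this have "z \<noteq> x" using x by blast
          ultimately show "\<not> (min x (pt a b 0 v) \<le> z \<and> z \<le> max x (pt a b 0 v))"
            using LD[of z] UD[of z] ab by (auto simp: pt_def min_def max_def split: if_splits)
        qed (use ab in auto)
      next
        case 2
        then obtain a where ab: "a \<in> H" "a v = Max L" "a v < x" using Lin by blast
        show ?thesis
        proof (rule free[OF pt[of a a 1]])
          fix z assume z: "z \<in> ?V"
          with x 2 have "z < x" by (force simp: U_def)
          with LD[OF z this] ab
          show "\<not> (min x (pt a a 1 v) \<le> z \<and> z \<le> max x (pt a a 1 v))"
            by (auto simp: pt_def min_def max_def)
        qed (use ab in auto)
      next
        case 3
        then obtain a where ab: "a \<in> H" "a v = Min U" "x < a v" using Uin by blast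
        show ?thesis
        proof (rule free[OF pt[of a a "-1"]])
          fix z assume z: "z \<in> ?V"
          with x 3 have "x < z" by (force simp: L_def)
          with UD[OF z this] ab
          show "\<not> (min x (pt a a (-1) v) \<le> z \<and> z \<le> max x (pt a a (-1) v))"
            by (auto simp: pt_def min_def max_def)
        qed (use ab in auto)
      qed
    qed
  qed
  ultimately show ?thesis by blast
qed

definition sign_determines ::
    "((nat \<Rightarrow> real) \<Rightarrow> real poly) set \<Rightarrow> ((nat \<Rightarrow> real) \<Rightarrow> bool) \<Rightarrow> bool" where
  "sign_determines F A \<longleftrightarrow> (\<forall>v x y. (\<forall>p\<in>F. sgn (poly (p v) x) = sgn (poly (p v) y)) \<longrightarrow>
     A (case_nat x v) = A (case_nat y v))"

lemma semialg_sign_determined: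
  assumes "semialg A"
  shows "\<exists>F. finite F \<and> (\<forall>p\<in>F. ppoly p) \<and> sign_determines F A"
  using assms
proof (induction rule: semialg.induct)
  case (semialg_pos P)
  obtain p where p: "ppoly p" "\<forall>v x. P (case_nat x v) = poly (p v) x"
    using polyfun_Cons_ppoly[OF semialg_pos] by blast
  have "sign_determines {p} (\<lambda>v. 0 < P v)"
    unfolding sign_determines_def
  proof (intro allI impI)
    fix v x y assume "\<forall>p\<in>{p}. sgn (poly (p v) x) = sgn (poly (p v) y)"
    then have sgn: "sgn (poly (p v) x) = sgn (poly (p v) y)" by simp
    have "(0 < poly (p v) x) = (0 < sgn (poly (p v) x))" by (rule sgn_greater[symmetric])
    also have "\<dots> = (0 < poly (p v) y)" unfolding sgn by (rule sgn_greater)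
    finally show "(0 < P (case_nat x v)) = (0 < P (case_nat y v))" by (simp only: p(2))
  qed
  with p(1) show ?case by (intro exI[of _ "{p}"]) simp
next
  case (semialg_not A)
  then show ?case by (simp add: sign_determines_def)
next
  case (semialg_disj A B)
  obtain F G where F: "finite F" "\<forall>p\<in>F. ppoly p" "sign_determines F A"
    and G: "finite G" "\<forall>p\<in>G. ppoly p" "sign_determines G B"
    using semialg_disj.IH by blast
  have "sign_determines (F \<union> G) (\<lambda>v. A v \<or> B v)"
    unfolding sign_determines_def
  proof (intro allI impI)
    fix v x y assume "\<forall>p\<in>F \<union> G. sgn (poly (p v) x) = sgn (poly (p v) y)"
    then have "A (case_nat x v) = A (case_nat y v)" "B (case_nat x v) = B (case_nat y v)"
      using F(3) G(3) unfolding sign_determines_def by simp_all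
    then show "(A (case_nat x v) \<or> B (case_nat x v)) = (A (case_nat y v) \<or> B (case_nat y v))"
      by (simp only:)
  qed
  with F G show ?case by (intro exI[of _ "F \<union> G"]) auto
qed

text \<open>The truth of \<open>A\<close> depends on the front variable only through the signs of
  finitely many polynomials. A witness can therefore be exchanged for a sample point with the same
  signs, and sample points are effective.\<close>

lemma semialg_ex_Cons:
  assumes "semialg A" shows "semialg (\<lambda>v. \<exists>x. A (case_nat x v))"
proof -
  obtain F where F: "finite F" "\<forall>p\<in>F. ppoly p" "sign_determines F A"
    using semialg_sign_determined[OF assms] by (elim exE conjE) simp
  obtain \<Xi> where \<Xi>: "finite \<Xi>" "\<forall>e\<in>\<Xi>. effective e"
    "\<forall>v x. \<exists>e\<in>\<Xi>. \<forall>p\<in>F. sgn (poly (p v) x) = sgn (poly (p v) (e v))"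
    using ex_sample_points[OF F(1,2)] by (elim exE conjE) simp
  have "(\<exists>x. A (case_nat x v)) \<longleftrightarrow> (\<exists>e\<in>\<Xi>. A (case_nat (e v) v))" for v
  proof
    assume "\<exists>x. A (case_nat x v)"
    then obtain x where x: "A (case_nat x v)" ..
    obtain e where e: "e \<in> \<Xi>" "\<forall>p\<in>F. sgn (poly (p v) x) = sgn (poly (p v) (e v))"
      using \<Xi>(3) by meson
    then have "A (case_nat x v) = A (case_nat (e v) v)"
      using F(3) unfolding sign_determines_def by simp
    with x e show "\<exists>e\<in>\<Xi>. A (case_nat (e v) v)" by metis
  qed blast
  moreover have "semialg (\<lambda>v. \<exists>e\<in>\<Xi>. A (case_nat (e v) v))"
    by (rule semialg_bex[OF \<Xi>(1)], rule semialg_subst[OF _ assms]) (use \<Xi>(2) in blast)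
  ultimately show ?thesis by (simp only:)
qed

lemma semialg_ex_upd:
  assumes "semialg A" shows "semialg (\<lambda>v. \<exists>x. A (v(i := x)))"
proof -
  have "v(i := x) = case_nat x v \<circ> (\<lambda>j. if j = i then 0 else Suc j)" for v :: "nat \<Rightarrow> real" and x
    by (auto simp: fun_eq_iff)
  then show ?thesis using semialg_ex_Cons[OF semialg_reindex[OF assms, of "\<lambda>j. if j = i then 0 else Suc j"]]
    by simp
qed

lemma semialg_ex_block:
  assumes "finite I" "semialg A"
  shows "semialg (\<lambda>v. \<exists>u. A (\<lambda>i. if i \<in> I then u i else v i))"
  using assms
proof (induction I arbitrary: A rule: finite_induct)
  case (insert k I)
  have "(\<exists>u. A (\<lambda>i. if i \<in> insert k I then u i else v i)) \<longleftrightarrow>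
     (\<exists>u x. A ((\<lambda>i. if i \<in> I then u i else v i)(k := x)))" for v
  proof safe
    fix u assume "A (\<lambda>i. if i \<in> insert k I then u i else v i)"
    moreover have "(\<lambda>i. if i \<in> insert k I then u i else v i) = (\<lambda>i. if i \<in> I then u i else v i)(k := u k)"
      by auto
    ultimately show "\<exists>u x. A ((\<lambda>i. if i \<in> I then u i else v i)(k := x))" by metis
  next
    fix u x assume "A ((\<lambda>i. if i \<in> I then u i else v i)(k := x))"
    moreover have "(\<lambda>i. if i \<in> I then u i else v i)(k := x) =
        (\<lambda>i. if i \<in> insert k I then (u(k := x)) i else v i)"
      using insert.hyps by auto
    ultimately show "\<exists>u. A (\<lambda>i. if i \<in> insert k I then u i else v i)" by metis
  qed
  then show ?case using insert.IH[OF semialg_ex_upd[OF insert.prems, of k]] by (simp only:)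
qed simp

section \<open>The set of non-proper points is semialgebraic\<close>

definition mpoly_function :: "(real ^ 'n::finite \<Rightarrow> real) \<Rightarrow> bool" where
  "mpoly_function Q \<longleftrightarrow> (\<exists>p. mpoly_eval p = Q)"

lemma mpoly_eval_superset:
  assumes "finite S" "Poly_Mapping.keys p \<subseteq> S"
  shows "mpoly_eval p x = (\<Sum>a\<in>S. Poly_Mapping.lookup p a * (\<Prod>i\<in>UNIV. (x $ i) ^ Poly_Mapping.lookup a i))"
  unfolding mpoly_eval_def
  by (rule sum.mono_neutral_left) (use assms in \<open>auto simp: in_keys_iff\<close>)

lemma mpoly_eval_add: "mpoly_eval (p + q) x = mpoly_eval p x + mpoly_eval q x"
proof -
  let ?S = "Poly_Mapping.keys p \<union> Poly_Mapping.keys q"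
  have S: "finite ?S" "Poly_Mapping.keys p \<subseteq> ?S" "Poly_Mapping.keys q \<subseteq> ?S"
    "Poly_Mapping.keys (p + q) \<subseteq> ?S"
    using Poly_Mapping.keys_add[of p q] by simp_all
  show ?thesis
    by (simp only: S(2-4)[THEN mpoly_eval_superset[OF S(1)]] lookup_add distrib_right sum.distrib)
qed

lemma mpoly_eval_single:
  "mpoly_eval (Poly_Mapping.single a c) x = c * (\<Prod>i\<in>UNIV. (x $ i) ^ Poly_Mapping.lookup a i)"
  by (subst mpoly_eval_superset[of "{a}"]) (auto simp: lookup_single)

lemma mpoly_function_monom:
  "mpoly_function (\<lambda>x. c * (\<Prod>i\<in>UNIV. (x $ i) ^ Poly_Mapping.lookup a i))"
  unfolding mpoly_function_def by (rule exI[of _ "Poly_Mapping.single a c"]) (simp add: fun_eq_iff mpoly_eval_single)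

lemma mpoly_function_add:
  "mpoly_function P \<Longrightarrow> mpoly_function Q \<Longrightarrow> mpoly_function (\<lambda>x. P x + Q x)"
  unfolding mpoly_function_def
proof (elim exE)
  fix p q assume "mpoly_eval p = P" "mpoly_eval q = Q"
  then show "\<exists>r. mpoly_eval r = (\<lambda>x. P x + Q x)"
    by (intro exI[of _ "p + q"]) (auto simp: fun_eq_iff mpoly_eval_add)
qed

lemma mpoly_function_const: "mpoly_function (\<lambda>x. c)"
  using mpoly_function_monom[of c 0] by simp

lemma mpoly_function_var: "mpoly_function (\<lambda>x. x $ k)"
proof -
  have "(\<Prod>i\<in>UNIV. (x $ i) ^ Poly_Mapping.lookup (Poly_Mapping.single k (1::nat)) i) = x $ k"
    for x :: "real ^ 'a"
    by (subst prod.remove[of _ k]) (auto simp: lookup_single when_def intro!: prod.neutral)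
  then show ?thesis using mpoly_function_monom[of 1 "Poly_Mapping.single k 1"] by simp
qed

lemma mpoly_function_sum:
  "(\<And>i. i \<in> I \<Longrightarrow> mpoly_function (P i)) \<Longrightarrow> mpoly_function (\<lambda>x. \<Sum>i\<in>I. P i x)"
proof (induction I rule: infinite_finite_induct)
  case (insert i I)
  then show ?case using mpoly_function_add[of "P i"] by simp
qed (simp_all add: mpoly_function_const)

lemma mpoly_function_mult:
  assumes "mpoly_function P" "mpoly_function Q"
  shows "mpoly_function (\<lambda>x. P x * Q x)"
proof -
  obtain p q where pq: "P = mpoly_eval p" "Q = mpoly_eval q"
    using assms unfolding mpoly_function_def by blast
  have "P x * Q x = (\<Sum>a\<in>Poly_Mapping.keys p. \<Sum>b\<in>Poly_Mapping.keys q.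
      (Poly_Mapping.lookup p a * Poly_Mapping.lookup q b) *
      (\<Prod>i\<in>UNIV. (x $ i) ^ Poly_Mapping.lookup (a + b) i))" for x
    unfolding pq mpoly_eval_def sum_product
    by (simp add: lookup_add power_add prod.distrib mult_ac)
  then show ?thesis by (simp only:) (intro mpoly_function_sum mpoly_function_monom)
qed

text \<open>The polynomial dependence of the environment on \<open>y\<close> leaves room for
  variables filled with constants.\<close>

lemma semialgebraic_semialg:
  fixes g :: "real ^ 'm::finite \<Rightarrow> nat \<Rightarrow> real"
  assumes g: "\<And>k. mpoly_function (\<lambda>y. g y k)" and "semialg A"
  shows "semialgebraic {y. A (g y)}"
  using assms(2)
proof (induction rule: semialg.induct)
  case (semialg_pos P)
  then have "mpoly_function (\<lambda>y. P (g y))"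
    by (induction rule: polyfun.induct) (auto intro: mpoly_function_const mpoly_function_add mpoly_function_mult g)
  then obtain p where "mpoly_eval p = (\<lambda>y. P (g y))" unfolding mpoly_function_def ..
  then show ?case using semialgebraic_pos[of p] by simp
next
  case (semialg_not A)
  show ?case unfolding Collect_neg_eq by (rule semialgebraic_Compl[OF semialg_not.IH])
next
  case (semialg_disj A B)
  then show ?case using semialgebraic_Un[of "{y. A (g y)}" "{y. B (g y)}"] by (simp add: Collect_disj_eq)
qed

lemma polyfun_mpoly_eval: "polyfun (\<lambda>v. mpoly_eval p (\<chi> i. v (\<iota> i)))"
  unfolding mpoly_eval_def by (simp only: vec_lambda_beta) (intro polyfun_intros)

lemma semialg_semialgebraic: "semialgebraic S \<Longrightarrow> semialg (\<lambda>v. (\<chi> i. v (\<iota> i)) \<in> S)"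
proof (induction rule: semialgebraic.induct)
  case (semialgebraic_pos p)
  show ?case unfolding mem_Collect_eq by (rule semialg_pos[OF polyfun_mpoly_eval])
next
  case (semialgebraic_Compl A)
  show ?case unfolding Compl_iff by (rule semialg_not[OF semialgebraic_Compl.IH])
next
  case (semialgebraic_Un A B)
  show ?case unfolding Un_iff by (rule semialg_disj[OF semialgebraic_Un.IH])
qed

lemma semialg_all_upd: "semialg A \<Longrightarrow> semialg (\<lambda>v. \<forall>x. A (v(i := x)))"
  using semialg_not[OF semialg_ex_upd[OF semialg_not, of A i]] by (simp only: not_ex not_not)

section \<open>Non-proper points as limits of values at escaping points\<close>

lemma continuous_on_mpoly_eval: "continuous_on S (mpoly_eval p)"
  unfolding mpoly_eval_def[abs_def] by (intro continuous_intros)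

lemma continuous_on_polynomial_map:
  assumes "polynomial_map_on X f d" shows "continuous_on X f"
proof -
  obtain F where F: "\<forall>x\<in>X. f x = (\<chi> j. mpoly_eval (F $ j) x)"
    using assms unfolding polynomial_map_on_def by blast
  have "continuous_on X (\<lambda>x. \<chi> j. mpoly_eval (F $ j) x)"
    by (intro continuous_on_vec_lambda continuous_on_mpoly_eval)
  then show ?thesis using F by (simp cong: continuous_on_cong)
qed

text \<open>Preimages of closed sets are closed in the closed set \<open>X\<close>, so by
  Heine-Borel their compactness is boundedness. The resulting criterion is of first order, as
  quantifier elimination requires, and suits limits of curves.\<close>

lemma mem_nonproper_set_iff:
  fixes f :: "'a::euclidean_space \<Rightarrow> 'b::metric_space"
  assumes X: "closed X" and f: "continuous_on X f"
  shows "y \<in> nonproper_set X f \<longleftrightarrow> (\<forall>e>0. \<forall>R. \<exists>x\<in>X. R < norm x \<and> dist (f x) y < e)"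
proof
  assume y: "y \<in> nonproper_set X f"
  show "\<forall>e>0. \<forall>R. \<exists>x\<in>X. R < norm x \<and> dist (f x) y < e"
  proof (rule ccontr)
    assume "\<not> ?thesis"
    then obtain e R where eR: "0 < e" "\<And>x. x \<in> X \<Longrightarrow> dist (f x) y < e \<Longrightarrow> norm x \<le> R"
      by (metis not_less)
    let ?K = "{x \<in> X. f x \<in> closure (ball y (e/2))}"
    have "closed ?K"
      using continuous_closed_preimage[OF f X closed_closure, of "ball y (e/2)"]
      by (simp add: vimage_def Int_def conj_commute)
    moreover have "norm x \<le> R" if "x \<in> ?K" for x
    proof (rule eR(2))
      have "f x \<in> cball y (e/2)"
        using that closure_minimal[OF ball_subset_cball closed_cball, of y "e/2"] by blast
      then show "dist (f x) y < e" using eR(1) by (simp add: dist_commute)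
    qed (use that in simp)
    then have "bounded ?K" unfolding bounded_iff by blast
    ultimately have "compact ?K" by (simp add: compact_eq_bounded_closed)
    then have "proper_at X f y"
      unfolding proper_at_def using eR(1) by (intro exI[of _ "ball y (e/2)"]) (simp add: interior_open)
    with y show False unfolding nonproper_set_def by blast
  qed
next
  assume R: "\<forall>e>0. \<forall>R. \<exists>x\<in>X. R < norm x \<and> dist (f x) y < e"
  have "y \<in> closure (f ` X)"
    unfolding closure_approachable using R by blast
  moreover have "\<not> proper_at X f y"
  proof
    assume "proper_at X f y"
    then obtain U where U: "y \<in> interior U" "compact {x \<in> X. f x \<in> closure U}"
      unfolding proper_at_def by blast
    obtain e where e: "0 < e" "ball y e \<subseteq> U" using U(1) by (auto simp: mem_interior)
    obtain B where B: "\<And>x. x \<in> {x \<in> X. f x \<in> closure U} \<Longrightarrow> norm x \<le> B"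
      using compact_imp_bounded[OF U(2)] unfolding bounded_iff by blast
    obtain x where x: "x \<in> X" "B < norm x" "dist (f x) y < e" using R e(1) by blast
    then have "f x \<in> closure U" using e(2) closure_subset[of U] by (auto simp: dist_commute)
    then show False using B[of x] x by simp
  qed
  ultimately show "y \<in> nonproper_set X f" unfolding nonproper_set_def by blast
qed

lemma closed_nonproper_set:
  fixes f :: "'a::euclidean_space \<Rightarrow> 'b::metric_space"
  assumes X: "closed X" and f: "continuous_on X f"
  shows "closed (nonproper_set X f)"
  unfolding closure_subset_eq[symmetric]
proof
  fix y assume "y \<in> closure (nonproper_set X f)"
  then have y: "\<forall>e>0. \<exists>z\<in>nonproper_set X f. dist z y < e" unfolding closure_approachable .
  show "y \<in> nonproper_set X f" unfolding mem_nonproper_set_iff[OF assms]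
  proof (intro allI impI)
    fix e R :: real assume "0 < e"
    then have e: "0 < e / 2" by simp
    with y obtain z where z: "z \<in> nonproper_set X f" "dist z y < e / 2" by blast
    then obtain x where "x \<in> X" "R < norm x" "dist (f x) z < e / 2"
      using e unfolding mem_nonproper_set_iff[OF assms] by blast
    moreover from this z have "dist (f x) y < e" using dist_triangle[of "f x" y z] by linarith
    ultimately show "\<exists>x\<in>X. R < norm x \<and> dist (f x) y < e" by blast
  qed
qed

lemma vec_norm_power2: "(norm (x :: real ^ 'n::finite))\<^sup>2 = (\<Sum>i\<in>UNIV. (x $ i)\<^sup>2)"
  by (simp add: norm_vec_def L2_set_def sum_nonneg)

text \<open>The criterion \<open>mem_nonproper_set_iff\<close> becomes a polynomial condition once
  norms and distances are squared, which is harmless because \<open>e\<close> and \<open>R\<close>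
  are arbitrary. Its quantifiers are then eliminated.\<close>

lemma semialgebraic_nonproper_set:
  fixes X :: "(real ^ 'n::finite) set" and f :: "real ^ 'n \<Rightarrow> real ^ 'm::finite"
  assumes X: "closed X" "semialgebraic X" and f: "polynomial_map_on X f d"
  shows "semialgebraic (nonproper_set X f)"
proof -
  obtain F where F: "\<And>x. x \<in> X \<Longrightarrow> f x = (\<chi> j. mpoly_eval (F $ j) x)"
    using f unfolding polynomial_map_on_def by blast
  obtain \<alpha> :: "'n \<Rightarrow> nat" and \<beta> :: "'m \<Rightarrow> nat" where inj: "inj \<alpha>" "inj \<beta>"
    using finite_imp_inj_to_nat_seg[of "UNIV :: 'n set"] finite_imp_inj_to_nat_seg[of "UNIV :: 'm set"]
    by auto
  \<comment> \<open>Residues modulo 3 separate the coordinates of \<open>x\<close>, those of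
    \<open>y\<close>, and the variables 2 and 5, which stand for \<open>e\<close> and
    \<open>R\<close>.\<close>
  define ix where "ix i = 3 * \<alpha> i" for i
  define iy where "iy j = 3 * \<beta> j + 1" for j
  have ij: "inj ix" "inj iy" using inj by (auto simp: inj_def ix_def iy_def)
  have ne: "iy j \<noteq> ix i" "ix i \<noteq> 2" "ix i \<noteq> 5" "iy j \<noteq> 2" "iy j \<noteq> 5" for i j
    by (auto simp: ix_def iy_def; presburger)+
  define A where "A v \<longleftrightarrow> 0 < v 2 \<longrightarrow> (\<exists>x\<in>X. v 5 < (\<Sum>i\<in>UNIV. (x $ i)\<^sup>2) \<and>
    (\<Sum>j\<in>UNIV. (mpoly_eval (F $ j) x - v (iy j))\<^sup>2) < v 2)" for v :: "nat \<Rightarrow> real"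
  define C where "C v \<longleftrightarrow> (\<chi> i. v (ix i)) \<in> X \<and> v 5 < (\<Sum>i\<in>UNIV. (v (ix i))\<^sup>2) \<and>
     (\<Sum>j\<in>UNIV. (mpoly_eval (F $ j) (\<chi> i. v (ix i)) - v (iy j))\<^sup>2) < v 2" for v :: "nat \<Rightarrow> real"
  have saC: "semialg C" unfolding C_def[abs_def]
    by (intro semialg_conj semialg_semialgebraic[OF X(2)] semialg_less polyfun_sum polyfun_power polyfun_var
        polyfun_diff polyfun_mpoly_eval)
  \<comment> \<open>Since \<open>ix\<close> is injective, the values of \<open>u\<close> on its
    range form an arbitrary vector \<open>x\<close>.\<close>
  have "A = (\<lambda>v. 0 < v 2 \<longrightarrow> (\<exists>u. C (\<lambda>k. if k \<in> range ix then u k else v k)))"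
  proof
    fix v
    have *: "C (\<lambda>k. if k \<in> range ix then u k else v k) \<longleftrightarrow> (\<chi> i. u (ix i)) \<in> X \<and>
        v 5 < (\<Sum>i\<in>UNIV. (u (ix i))\<^sup>2) \<and>
        (\<Sum>j\<in>UNIV. (mpoly_eval (F $ j) (\<chi> i. u (ix i)) - v (iy j))\<^sup>2) < v 2" for u
    proof -
      have "5 \<notin> range ix" "2 \<notin> range ix" "\<And>j. iy j \<notin> range ix" using ne by (metis rangeE)+
      then show ?thesis by (simp add: C_def)
    qed
    show "A v \<longleftrightarrow> (0 < v 2 \<longrightarrow> (\<exists>u. C (\<lambda>k. if k \<in> range ix then u k else v k)))"
    proof (cases "0 < v 2")
      case True
      have "A v \<longleftrightarrow> (\<exists>u. C (\<lambda>k. if k \<in> range ix then u k else v k))"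
        unfolding *
      proof
        assume "A v"
        then obtain x where x: "x \<in> X" "v 5 < (\<Sum>i\<in>UNIV. (x $ i)\<^sup>2)"
          "(\<Sum>j\<in>UNIV. (mpoly_eval (F $ j) x - v (iy j))\<^sup>2) < v 2"
          using True unfolding A_def by blast
        have "inv ix (ix i) = i" for i using ij(1) by (simp add: inv_f_f)
        with x show "\<exists>u. (\<chi> i. u (ix i)) \<in> X \<and> v 5 < (\<Sum>i\<in>UNIV. (u (ix i))\<^sup>2) \<and>
            (\<Sum>j\<in>UNIV. (mpoly_eval (F $ j) (\<chi> i. u (ix i)) - v (iy j))\<^sup>2) < v 2"
          by (intro exI[of _ "\<lambda>k. x $ inv ix k"]) (simp add: vec_nth_inverse)
      next
        assume "\<exists>u. (\<chi> i. u (ix i)) \<in> X \<and> v 5 < (\<Sum>i\<in>UNIV. (u (ix i))\<^sup>2) \<and>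
            (\<Sum>j\<in>UNIV. (mpoly_eval (F $ j) (\<chi> i. u (ix i)) - v (iy j))\<^sup>2) < v 2"
        then obtain u where "(\<chi> i. u (ix i)) \<in> X" "v 5 < (\<Sum>i\<in>UNIV. (u (ix i))\<^sup>2)"
            "(\<Sum>j\<in>UNIV. (mpoly_eval (F $ j) (\<chi> i. u (ix i)) - v (iy j))\<^sup>2) < v 2" by blast
        then show "A v" unfolding A_def by (intro impI bexI[of _ "\<chi> i. u (ix i)"]) simp_all
      qed
      with True show ?thesis by simp
    qed (simp add: A_def)
  qed
  moreover have "semialg (\<lambda>v. 0 < v 2 \<longrightarrow> (\<exists>u. C (\<lambda>k. if k \<in> range ix then u k else v k)))"
    by (intro semialg_imp semialg_ex_block saC semialg_pos polyfun_var) simp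
  ultimately have "semialg A" by (simp only:)
  from semialg_all_upd[OF semialg_all_upd[OF this, of 5], of 2]
  have saD: "semialg (\<lambda>v. \<forall>e R. A (v(2 := e, 5 := R)))" .
  define g where "g y k = (if k \<in> range iy then y $ inv iy k else 0)" for y :: "real ^ 'm" and k
  have "mpoly_function (\<lambda>y. g y k)" for k
    by (cases "k \<in> range iy") (simp_all add: g_def mpoly_function_var mpoly_function_const)
  from semialgebraic_semialg[OF this saD]
  have "semialgebraic {y. \<forall>e R. A ((g y)(2 := e, 5 := R))}" .
  moreover have "(\<forall>e R. A ((g y)(2 := e, 5 := R))) \<longleftrightarrow> y \<in> nonproper_set X f" for y
  proof -
    have gy: "g y (iy j) = y $ j" for j using ij(2) by (simp add: g_def inv_f_f)
    have "A ((g y)(2 := e, 5 := R)) \<longleftrightarrow> (0 < e \<longrightarrow> (\<exists>x\<in>X. R < (norm x)\<^sup>2 \<and> (dist (f x) y)\<^sup>2 < e))" for e R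
      unfolding A_def dist_norm vec_norm_power2
      using F ne by (simp add: gy cong: bex_cong)
    then have "(\<forall>e R. A ((g y)(2 := e, 5 := R))) \<longleftrightarrow>
        (\<forall>e>0. \<forall>R. \<exists>x\<in>X. R < (norm x)\<^sup>2 \<and> (dist (f x) y)\<^sup>2 < e)" by blast
    also have "\<dots> \<longleftrightarrow> (\<forall>e>0. \<forall>R. \<exists>x\<in>X. R < norm x \<and> dist (f x) y < e)"
    proof (intro iffI allI impI)
      fix e R :: real
      assume *: "\<forall>e>0. \<forall>R. \<exists>x\<in>X. R < (norm x)\<^sup>2 \<and> (dist (f x) y)\<^sup>2 < e" and "0 < e"
      then obtain x where "x \<in> X" "R\<^sup>2 < (norm x)\<^sup>2" "(dist (f x) y)\<^sup>2 < e\<^sup>2"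
        by (metis zero_less_power)
      with \<open>0 < e\<close> show "\<exists>x\<in>X. R < norm x \<and> dist (f x) y < e"
        by (intro bexI[of _ x] conjI) (auto intro: power2_less_imp_less)
    next
      fix e R :: real
      assume *: "\<forall>e>0. \<forall>R. \<exists>x\<in>X. R < norm x \<and> dist (f x) y < e" and "0 < e"
      then obtain x where x: "x \<in> X" "sqrt \<bar>R\<bar> < norm x" "dist (f x) y < sqrt e"
        by (metis real_sqrt_gt_zero)
      have "\<bar>R\<bar> < (norm x)\<^sup>2" using x(2) by (metis real_less_lsqrt not_less real_le_rsqrt real_sqrt_le_iff norm_ge_zero real_sqrt_abs abs_norm_cancel real_sqrt_less_iff)
      moreover have "(dist (f x) y)\<^sup>2 < e" using x(3) by (metis real_sqrt_less_iff real_sqrt_abs abs_of_nonneg zero_le_dist)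
      ultimately show "\<exists>x\<in>X. R < (norm x)\<^sup>2 \<and> (dist (f x) y)\<^sup>2 < e" using x(1) by force
    qed
    also have "\<dots> \<longleftrightarrow> y \<in> nonproper_set X f"
      by (rule mem_nonproper_set_iff[OF X(1) continuous_on_polynomial_map[OF f], symmetric])
    finally show ?thesis .
  qed
  ultimately show ?thesis by simp
qed

section \<open>Parametric curves of non-proper points\<close>

lemma degree_mpoly_eval_poly_map:
  fixes p :: "real poly ^ 'n::finite"
  assumes p: "poly_map_degree p \<le> d"
  shows "\<exists>q. degree q \<le> d * mpoly_degree F \<and> (\<forall>t. mpoly_eval F (poly_map p t) = poly q t)"
proof (intro exI conjI allI)
  let ?q = "\<Sum>a\<in>Poly_Mapping.keys F. smult (Poly_Mapping.lookup F a)
    (\<Prod>i\<in>UNIV. (p $ i) ^ Poly_Mapping.lookup a i)"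
  show "mpoly_eval F (poly_map p t) = poly ?q t" for t
    by (simp add: mpoly_eval_def poly_map_def poly_sum poly_prod)
  have pi: "degree (p $ i) \<le> d" for i
    using p unfolding poly_map_degree_def by simp
  have "degree (\<Prod>i\<in>UNIV. (p $ i) ^ Poly_Mapping.lookup a i) \<le> d * mpoly_degree F"
    if a: "a \<in> Poly_Mapping.keys F" for a
  proof -
    have "degree (\<Prod>i\<in>UNIV. (p $ i) ^ Poly_Mapping.lookup a i)
        \<le> (\<Sum>i\<in>UNIV. degree ((p $ i) ^ Poly_Mapping.lookup a i))"
      using degree_prod_sum_le[of UNIV "\<lambda>i. (p $ i) ^ Poly_Mapping.lookup a i"] by (simp add: comp_def)
    also have "\<dots> \<le> (\<Sum>i\<in>UNIV. d * Poly_Mapping.lookup a i)"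
      by (intro sum_mono order_trans[OF degree_power_le] mult_right_mono pi) simp
    also have "\<dots> = d * (\<Sum>i\<in>UNIV. Poly_Mapping.lookup a i)" by (simp add: sum_distrib_left)
    also have "\<dots> \<le> d * mpoly_degree F"
      unfolding mpoly_degree_def using a by (intro mult_left_mono Max_ge) auto
    finally show ?thesis .
  qed
  then show "degree ?q \<le> d * mpoly_degree F"
    by (intro degree_sum_le order_trans[OF degree_smult_le]) auto
qed

lemma ex_poly_map_compose:
  fixes f :: "real ^ 'n::finite \<Rightarrow> real ^ 'm::finite"
  assumes f: "polynomial_map_on X f d2" and p: "poly_map_degree p \<le> d1" "range (poly_map p) \<subseteq> X"
  shows "\<exists>q. poly_map_degree q \<le> d1 * d2 \<and> (\<forall>t. poly_map q t = f (poly_map p t))"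
proof -
  obtain F :: "'n mpoly ^ 'm" where F: "\<And>x. x \<in> X \<Longrightarrow> f x = (\<chi> j. mpoly_eval (F $ j) x)"
    and d2: "d2 = Max (range (\<lambda>j. mpoly_degree (F $ j)))"
    using f unfolding polynomial_map_on_def by blast
  have "\<forall>j. \<exists>q. degree q \<le> d1 * mpoly_degree (F $ j) \<and> (\<forall>t. mpoly_eval (F $ j) (poly_map p t) = poly q t)"
    using degree_mpoly_eval_poly_map[OF p(1)] by blast
  then obtain q where q: "\<And>j. degree (q j) \<le> d1 * mpoly_degree (F $ j)"
    "\<And>j t. mpoly_eval (F $ j) (poly_map p t) = poly (q j) t" by metis
  have "degree (q j) \<le> d1 * d2" for j
    by (rule order_trans[OF q(1)]) (simp add: d2)
  moreover have "poly_map (\<chi> j. q j) t = f (poly_map p t)" for t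
    using p(2) F by (simp add: poly_map_def[of "\<chi> j. q j"] q(2)[symmetric] range_subsetD)
  ultimately show ?thesis unfolding poly_map_degree_def by (intro exI[of _ "\<chi> j. q j"]) simp
qed

section \<open>Vector coefficients of polynomial maps\<close>

definition vcoeff :: "real poly ^ 'n \<Rightarrow> nat \<Rightarrow> real ^ 'n::finite" where
  "vcoeff p j = (\<chi> i. coeff (p $ i) j)"

lemma poly_map_eq_sum:
  assumes "poly_map_degree p \<le> d"
  shows "poly_map p t = (\<Sum>j\<le>d. t ^ j *\<^sub>R vcoeff p j)"
proof -
  have deg: "degree (p $ i) \<le> d" for i using assms unfolding poly_map_degree_def by simp
  show ?thesis
    by (simp add: vec_eq_iff poly_map_def vcoeff_def sum_component poly_eq_sum_le[OF deg] mult.commute)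
qed

lemma ex_poly_map_of_coeffs:
  fixes A :: "nat \<Rightarrow> real ^ 'n::finite"
  shows "\<exists>q. poly_map_degree q \<le> d \<and> (\<forall>t. poly_map q t = (\<Sum>j\<le>d. t ^ j *\<^sub>R A j))"
proof (intro exI conjI allI)
  let ?q = "\<chi> i. \<Sum>j\<le>d. monom (A j $ i) j"
  show "poly_map_degree ?q \<le> d"
    unfolding poly_map_degree_def
    by (auto intro!: degree_sum_le order_trans[OF degree_monom_le])
  show "poly_map ?q t = (\<Sum>j\<le>d. t ^ j *\<^sub>R A j)" for t
    by (simp add: vec_eq_iff poly_map_def sum_component poly_sum poly_monom mult.commute)
qed

lemma finite_zeros_vector_poly:
  fixes A :: "nat \<Rightarrow> real ^ 'n::finite"
  assumes "k \<le> d" "A k \<noteq> 0"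
  shows "finite {t. (\<Sum>j\<le>d. t ^ j *\<^sub>R A j) = 0}"
proof -
  obtain i where i: "A k $ i \<noteq> 0" using assms(2) by (auto simp: vec_eq_iff)
  have "finite {t. (\<Sum>j\<le>d. A j $ i * t ^ j) = 0}"
    using assms(1) i by (subst polyfun_finite_roots) auto
  then show ?thesis
    by (rule rev_finite_subset) (auto simp: vec_eq_iff sum_component mult.commute)
qed

lemma continuous_on_poly_map: "continuous_on S (poly_map p)"
  unfolding poly_map_def[abs_def] by (intro continuous_intros)

text \<open>A finite non-empty connected set is a single point. Hence a curve cannot lie in a finite
  fibre of \<open>f\<close>.\<close>

lemma infinite_range_poly_map:
  assumes "\<not> poly_map p constant_on UNIV" shows "infinite (range (poly_map p))"
proof
  assume "finite (range (poly_map p))"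
  moreover have "connected (range (poly_map p))"
    by (intro connected_continuous_image continuous_on_poly_map connected_UNIV)
  ultimately obtain c where "range (poly_map p) = {c}"
    using connected_finite_iff_sing by blast
  then show False using assms unfolding constant_on_def by blast
qed

text \<open>A translation of the parameter puts the point at parameter 0, which every later
  rescaling leaves fixed.\<close>

lemma parametric_curve_through:
  assumes "uniruledness_degree_le X d" "x \<in> X"
  obtains p where "poly_map p 0 = x" "range (poly_map p) \<subseteq> X" "poly_map_degree p \<le> d"
    "infinite (range (poly_map p))"
proof -
  obtain p where p: "\<not> poly_map p constant_on UNIV" "range (poly_map p) \<subseteq> X"
    "poly_map_degree p \<le> d" "x \<in> range (poly_map p)"
    using assms unfolding uniruledness_degree_le_def parametric_curve_in_def by blast
  then obtain s where s: "x = poly_map p s" by blast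
  let ?p = "\<chi> i. pcompose (p $ i) [:s, 1:]"
  have eq: "poly_map ?p t = poly_map p (s + t)" for t
    by (simp add: poly_map_def poly_pcompose)
  have "range (poly_map ?p) = range (poly_map p)"
  proof
    show "range (poly_map p) \<subseteq> range (poly_map ?p)"
    proof
      fix z assume "z \<in> range (poly_map p)"
      then obtain u where "z = poly_map p u" by blast
      then have "z = poly_map ?p (u - s)" by (simp add: eq)
      then show "z \<in> range (poly_map ?p)" by blast
    qed
  qed (auto simp: eq)
  moreover have "poly_map_degree ?p \<le> d"
    using p(3) by (simp add: poly_map_degree_def degree_pcompose)
  ultimately show ?thesis
    using that[of ?p] p(2) infinite_range_poly_map[OF p(1)] eq[of 0] s by simp
qed

section \<open>Convergence and normalisation of coefficients\<close>

lemma bounded_coeffs_convergent_subsequence: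
  fixes a :: "nat \<Rightarrow> nat \<Rightarrow> 'a::heine_borel"
  assumes "\<And>j. j < d \<Longrightarrow> bounded (range (\<lambda>k. a k j))"
  shows "\<exists>r l. strict_mono (r :: nat \<Rightarrow> nat) \<and> (\<forall>j<d. (\<lambda>k. a (r k) j) \<longlonglongrightarrow> l j)"
  using assms
proof (induction d)
  case 0
  then show ?case using strict_mono_id by blast
next
  case (Suc d)
  then obtain r l where r: "strict_mono (r :: nat \<Rightarrow> nat)" "\<And>j. j < d \<Longrightarrow> (\<lambda>k. a (r k) j) \<longlonglongrightarrow> l j"
    by (meson less_SucI)
  have "bounded (range (\<lambda>k. a (r k) d))"
    by (rule bounded_subset[OF Suc.prems[of d]]) auto
  then obtain m s where s: "strict_mono (s :: nat \<Rightarrow> nat)" "((\<lambda>k. a (r k) d) \<circ> s) \<longlonglongrightarrow> m"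
    using bounded_imp_convergent_subsequence by blast
  have "(\<lambda>k. a ((r \<circ> s) k) j) \<longlonglongrightarrow> (l(d := m)) j" if "j < Suc d" for j
  proof (cases "j = d")
    case True
    then show ?thesis using s(2) by (simp add: comp_def)
  next
    case False
    then have "j < d" using that by simp
    from LIMSEQ_subseq_LIMSEQ[OF r(2)[OF this] s(1)] show ?thesis using False by (simp add: comp_def)
  qed
  then show ?case using strict_mono_o[OF r(1) s(1)] by blast
qed

text \<open>The parameter of a non-constant curve is rescaled so that the coefficients of positive
  degree keep a non-zero limit.\<close>

lemma ex_normalizing_scale:
  fixes a :: "nat \<Rightarrow> 'a::real_normed_vector"
  assumes "1 \<le> i" "i \<le> d" "a i \<noteq> 0"
  shows "\<exists>s::real. (\<Sum>j=1..d. norm (s ^ j *\<^sub>R a j)) = 1"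
proof -
  define S where "S s = (\<Sum>j=1..d. norm (s ^ j *\<^sub>R a j))" for s :: real
  \<comment> \<open>At \<open>u\<close> the summand of index \<open>i\<close> alone is at least 1,
    while \<open>S\<close> vanishes at 0; the intermediate value theorem supplies the scale.\<close>
  define u where "u = max 1 (1 / norm (a i))"
  have u: "1 \<le> u" "1 \<le> u * norm (a i)" using assms(3) by (auto simp: u_def max_def field_simps)
  have "1 \<le> u * norm (a i)" by fact
  also have "\<dots> \<le> norm (u ^ i *\<^sub>R a i)"
    using u(1) assms(1) by (auto intro!: mult_right_mono self_le_power)
  also have "\<dots> \<le> S u" unfolding S_def using assms by (intro member_le_sum) auto
  finally have "1 \<le> S u" .
  moreover have "S 0 = 0" unfolding S_def by (intro sum.neutral) auto
  moreover have "continuous_on {0..u} S" unfolding S_def by (intro continuous_intros)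
  ultimately have "\<exists>s\<ge>0. s \<le> u \<and> S s = 1" using u(1) by (intro IVT') auto
  then show ?thesis unfolding S_def by blast
qed

section \<open>Limit curves in the set of non-proper points\<close>

lemma parametric_curve_in_nonproper_set:
  fixes X :: "(real ^ 'n::finite) set" and f :: "real ^ 'n \<Rightarrow> real ^ 'm::finite"
  assumes X: "closed X" and ruled: "uniruledness_degree_le X d1"
    and f: "polynomial_map_on X f d2" and gf: "generically_finite_on X f"
    and y: "y \<in> nonproper_set X f"
  shows "\<exists>l. parametric_curve_in (nonproper_set X f) (d1 * d2) l \<and> y \<in> l"
proof -
  let ?D = "d1 * d2"
  have contf: "continuous_on X f" by (rule continuous_on_polynomial_map[OF f])
  note mem = mem_nonproper_set_iff[OF X contf]
  define Bad where "Bad = {x \<in> X. infinite {z \<in> X. f z = f x}}"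
  \<comment> \<open>A relatively open subset of \<open>Bad\<close> lies in the interior of its
    closure, which is empty by generic finiteness.\<close>
  have dense: "\<exists>x'\<in>X - Bad. x' \<in> U" if "x \<in> X" "x \<in> U" "openin (top_of_set X) U" for x U
  proof (rule ccontr)
    assume "\<not> ?thesis"
    then have "U \<subseteq> Bad" using openin_imp_subset[OF that(3)] by blast
    moreover have "Bad \<subseteq> (top_of_set X) closure_of Bad"
      by (rule closure_of_subset) (auto simp: Bad_def)
    ultimately have "U \<subseteq> (top_of_set X) interior_of ((top_of_set X) closure_of Bad)"
      by (intro interior_of_maximal that(3)) blast
    then show False using gf that(2) unfolding generically_finite_on_def nowhere_dense_in_def Bad_def by blast
  qed
  have "\<exists>p. poly_map_degree p \<le> d1 \<and> range (poly_map p) \<subseteq> X \<and> real k < norm (poly_map p 0) \<and>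
      dist (f (poly_map p 0)) y < 1 / real (Suc k) \<and> (\<exists>t. f (poly_map p t) \<noteq> f (poly_map p 0))" for k
  proof -
    obtain x where x: "x \<in> X" "real k < norm x" "dist (f x) y < 1 / real (Suc k)"
      using y unfolding mem by (metis of_nat_0_less_iff zero_less_Suc zero_less_divide_1_iff)
    \<comment> \<open>Both estimates are open conditions on \<open>X\<close>, so \<open>x\<close>
      can be replaced by a point with finite fibre that still satisfies them.\<close>
    let ?U = "X \<inter> (\<lambda>x. (norm x, dist (f x) y)) -` ({real k<..} \<times> {..<1 / real (Suc k)})"
    have "openin (top_of_set X) ?U"
      by (intro continuous_openin_preimage_gen continuous_on_Pair continuous_on_norm continuous_on_dist
          continuous_on_const continuous_on_id contf open_Times open_greaterThan open_lessThan)
    then obtain x' where x': "x' \<in> X - Bad" "x' \<in> ?U" using dense[of x ?U] x by auto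
    obtain p where p: "poly_map p 0 = x'" "range (poly_map p) \<subseteq> X" "poly_map_degree p \<le> d1"
      "infinite (range (poly_map p))"
      using parametric_curve_through[OF ruled, of x'] x'(1) by blast
    have "\<exists>t. f (poly_map p t) \<noteq> f (poly_map p 0)"
    proof (rule ccontr)
      assume "\<not> ?thesis"
      then have "range (poly_map p) \<subseteq> {z \<in> X. f z = f x'}" using p by auto
      then have "infinite {z \<in> X. f z = f x'}" using p(4) finite_subset by blast
      then show False using x'(1) by (auto simp: Bad_def)
    qed
    with p x' show ?thesis by (intro exI[of _ p]) auto
  qed
  then obtain p where p: "\<And>k. poly_map_degree (p k) \<le> d1" "\<And>k. range (poly_map (p k)) \<subseteq> X"
    "\<And>k. real k < norm (poly_map (p k) 0)" "\<And>k. dist (f (poly_map (p k) 0)) y < 1 / real (Suc k)"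
    "\<And>k. \<exists>t. f (poly_map (p k) t) \<noteq> f (poly_map (p k) 0)" by metis
  have "\<forall>k. \<exists>q. poly_map_degree q \<le> ?D \<and> (\<forall>t. poly_map q t = f (poly_map (p k) t))"
    using ex_poly_map_compose[OF f p(1,2)] by blast
  then obtain q where q: "\<And>k. poly_map_degree (q k) \<le> ?D" "\<And>k t. poly_map (q k) t = f (poly_map (p k) t)"
    by metis
  have "\<exists>s. (\<Sum>j=1..?D. norm (s ^ j *\<^sub>R vcoeff (q k) j)) = 1" for k
  proof -
    have "\<exists>i. 1 \<le> i \<and> i \<le> ?D \<and> vcoeff (q k) i \<noteq> 0"
    proof (rule ccontr)
      assume "\<not> ?thesis"
      then have z: "vcoeff (q k) i = 0" if "0 < i" "i \<le> ?D" for i using that by force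
      have "poly_map (q k) t = vcoeff (q k) 0" for t
        unfolding poly_map_eq_sum[OF q(1)] by (subst sum.remove[of _ 0]) (auto simp: z)
      then show False using p(5)[of k] unfolding q(2)[symmetric] by simp
    qed
    then show ?thesis using ex_normalizing_scale by blast
  qed
  then obtain s where s: "\<And>k. (\<Sum>j=1..?D. norm (s k ^ j *\<^sub>R vcoeff (q k) j)) = 1" by metis
  \<comment> \<open>One scale serves the curve and its image, so \<open>b k\<close> and
    \<open>a k\<close> are the coefficients of a curve in \<open>X\<close> and of its image under
    \<open>f\<close>; see \<open>P\<close> and \<open>G\<close>.\<close>
  define a where "a k j = s k ^ j *\<^sub>R vcoeff (q k) j" for k j
  define b where "b k j = s k ^ j *\<^sub>R vcoeff (p k) j" for k j
  \<comment> \<open>\<open>M k\<close> dominates the norm of the constant coefficient, which is the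
    escaping point at parameter 0, and so tends to infinity.\<close>
  define M where "M k = (\<Sum>j\<le>d1. norm (b k j))" for k
  define c where "c k j = b k j /\<^sub>R M k" for k j
  have G: "(\<Sum>j\<le>?D. t ^ j *\<^sub>R a k j) = f (poly_map (p k) (s k * t))" for k t
    unfolding q(2)[symmetric] poly_map_eq_sum[OF q(1)] a_def by (simp add: power_mult_distrib mult.commute)
  have P: "(\<Sum>j\<le>d1. t ^ j *\<^sub>R b k j) = poly_map (p k) (s k * t)" for k t
    unfolding poly_map_eq_sum[OF p(1)] b_def by (simp add: power_mult_distrib mult.commute)
  have at0: "(\<Sum>j\<le>d. 0 ^ j *\<^sub>R h j) = h 0" for d and h :: "nat \<Rightarrow> 'v::real_vector"
    by (subst sum.remove[of _ 0]) (auto intro: sum.neutral)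
  have a0: "a k 0 = f (poly_map (p k) 0)" for k using G[of 0 k] by (simp add: at0)
  have M: "real k < M k" for k
  proof -
    have "real k < norm (b k 0)" using p(3)[of k] P[of 0 k] by (simp add: at0)
    also have "\<dots> \<le> M k" unfolding M_def by (intro member_le_sum) auto
    finally show ?thesis .
  qed
  then have Mpos: "0 < M k" for k by (meson le_less_trans of_nat_0_le_iff)
  have csum: "(\<Sum>j\<le>d1. norm (c k j)) = 1" for k
    using Mpos[of k] by (simp add: c_def M_def[symmetric] sum_divide_distrib[symmetric] divide_inverse_commute
       flip: sum_distrib_left)
  have a0lim: "(\<lambda>k. a k 0) \<longlonglongrightarrow> y"
  proof (rule tendsto_dist_iff[THEN iffD2], rule Lim_null_comparison[OF _ LIMSEQ_inverse_real_of_nat])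
    show "\<forall>\<^sub>F k in sequentially. norm (dist (a k 0) y) \<le> inverse (real (Suc k))"
      using p(4) by (intro always_eventually allI) (simp add: a0 inverse_eq_divide less_imp_le)
  qed
  have "bounded (range (\<lambda>k. a k j))" if "j < Suc ?D" for j
  proof (cases "j = 0")
    case True
    then show ?thesis using convergent_imp_bounded[OF a0lim] by simp
  next
    case False
    have "norm (a k j) \<le> 1" for k
      using False that s[of k] member_le_sum[of j "{1..?D}" "\<lambda>j. norm (a k j)"] by (auto simp: a_def)
    then show ?thesis unfolding bounded_iff by blast
  qed
  then obtain r A where r: "strict_mono (r :: nat \<Rightarrow> nat)" "\<And>j. j < Suc ?D \<Longrightarrow> (\<lambda>k. a (r k) j) \<longlonglongrightarrow> A j"
    using bounded_coeffs_convergent_subsequence[of "Suc ?D" a] by blast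
  have "bounded (range (\<lambda>k. c (r k) j))" if "j < Suc d1" for j
  proof -
    have "norm (c k j) \<le> 1" for k
      using that csum[of k] member_le_sum[of j "{..d1}" "\<lambda>j. norm (c k j)"] by auto
    then show ?thesis unfolding bounded_iff by blast
  qed
  then obtain r' C where r': "strict_mono (r' :: nat \<Rightarrow> nat)"
    "\<And>j. j < Suc d1 \<Longrightarrow> (\<lambda>k. c (r (r' k)) j) \<longlonglongrightarrow> C j"
    using bounded_coeffs_convergent_subsequence[of "Suc d1" "\<lambda>k. c (r k)"] by blast
  define h where "h k = r (r' k)" for k
  have h: "strict_mono h" using strict_mono_o[OF r(1) r'(1)] by (simp add: h_def[abs_def] comp_def)
  have alim: "(\<lambda>k. a (h k) j) \<longlonglongrightarrow> A j" if "j \<le> ?D" for j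
    using LIMSEQ_subseq_LIMSEQ[OF r(2) r'(1), of j] that by (simp add: h_def comp_def)
  have clim: "(\<lambda>k. c (h k) j) \<longlonglongrightarrow> C j" if "j \<le> d1" for j
    using r'(2)[of j] that by (simp add: h_def)
  \<comment> \<open>Norm sums equal to 1 pass to the limit. Hence some \<open>A i\<close> of
    positive degree is non-zero, and likewise below some \<open>C i'\<close>, possibly the constant
    one.\<close>
  have "(\<lambda>k. \<Sum>j=1..?D. norm (a (h k) j)) \<longlonglongrightarrow> (\<Sum>j=1..?D. norm (A j))"
    by (intro tendsto_sum tendsto_norm alim) simp
  then have "(\<Sum>j=1..?D. norm (A j)) = 1"
    using s by (simp add: a_def LIMSEQ_const_iff)
  then obtain i where i: "1 \<le> i" "i \<le> ?D" "A i \<noteq> 0"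
    by (metis atLeastAtMost_iff norm_zero sum.neutral zero_neq_one)
  have "(\<lambda>k. \<Sum>j\<le>d1. norm (c (h k) j)) \<longlonglongrightarrow> (\<Sum>j\<le>d1. norm (C j))"
    by (intro tendsto_sum tendsto_norm clim) simp
  then have "(\<Sum>j\<le>d1. norm (C j)) = 1"
    using csum by (simp add: LIMSEQ_const_iff)
  then obtain i' where i': "i' \<le> d1" "C i' \<noteq> 0"
    by (metis atMost_iff norm_zero sum.neutral zero_neq_one)
  have A0: "A 0 = y"
    using alim[of 0] LIMSEQ_subseq_LIMSEQ[OF a0lim h] LIMSEQ_unique by (auto simp: comp_def)
  obtain Q where Q: "poly_map_degree Q \<le> ?D" "\<And>t. poly_map Q t = (\<Sum>j\<le>?D. t ^ j *\<^sub>R A j)"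
    using ex_poly_map_of_coeffs by metis
  let ?Z = "{t. (\<Sum>j\<le>d1. t ^ j *\<^sub>R C j) = 0}"
  have Z: "finite ?Z" by (rule finite_zeros_vector_poly[of i' d1 C, OF i'])
  \<comment> \<open>Off \<open>?Z\<close> the point \<open>?x k\<close> is \<open>M (h k)\<close>
    times a vector with non-zero limit and escapes to infinity, while its image converges to
    \<open>poly_map Q t\<close>.\<close>
  have generic: "poly_map Q t \<in> nonproper_set X f" if t: "t \<notin> ?Z" for t
  proof -
    let ?x = "\<lambda>k. poly_map (p (h k)) (s (h k) * t)"
    have "(\<lambda>k. \<Sum>j\<le>d1. t ^ j *\<^sub>R c (h k) j) \<longlonglongrightarrow> (\<Sum>j\<le>d1. t ^ j *\<^sub>R C j)"
      by (intro tendsto_sum tendsto_scaleR tendsto_const clim) simp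
    then have "(\<lambda>k. norm (\<Sum>j\<le>d1. t ^ j *\<^sub>R c (h k) j)) \<longlonglongrightarrow> norm (\<Sum>j\<le>d1. t ^ j *\<^sub>R C j)"
      by (rule tendsto_norm)
    moreover have "filterlim (\<lambda>k. M (h k)) at_top sequentially"
      by (rule filterlim_at_top_mono[OF filterlim_real_sequentially])
        (intro always_eventually allI, use M seq_suble[OF h] in \<open>meson less_imp_le of_nat_le_iff order_trans\<close>)
    ultimately have "filterlim (\<lambda>k. norm (\<Sum>j\<le>d1. t ^ j *\<^sub>R c (h k) j) * M (h k)) at_top sequentially"
      using t by (intro filterlim_tendsto_pos_mult_at_top) auto
    moreover have "norm (\<Sum>j\<le>d1. t ^ j *\<^sub>R c (h k) j) * M (h k) = norm (?x k)" for k
    proof -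
      have "?x k = M (h k) *\<^sub>R (\<Sum>j\<le>d1. t ^ j *\<^sub>R c (h k) j)"
        unfolding P[symmetric] c_def scaleR_sum_right
        using Mpos[of "h k"] by (intro sum.cong) (simp_all add: field_simps)
      then show ?thesis using Mpos[of "h k"] by simp
    qed
    ultimately have inf: "filterlim (\<lambda>k. norm (?x k)) at_top sequentially" by simp
    have lim: "(\<lambda>k. f (?x k)) \<longlonglongrightarrow> poly_map Q t"
      unfolding G[symmetric] Q(2) by (intro tendsto_sum tendsto_scaleR tendsto_const alim) simp
    show ?thesis unfolding mem
    proof (intro allI impI)
      fix e R :: real assume "0 < e"
      have "\<forall>\<^sub>F k in sequentially. R < norm (?x k) \<and> dist (f (?x k)) (poly_map Q t) < e"
        using inf tendstoD[OF lim \<open>0 < e\<close>] by (intro eventually_conj) (auto simp: filterlim_at_top_dense)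
      from eventually_happens'[OF sequentially_bot this]
      obtain k where "R < norm (?x k)" "dist (f (?x k)) (poly_map Q t) < e" by (elim exE conjE)
      moreover have "?x k \<in> X" using p(2) by blast
      ultimately show "\<exists>x\<in>X. R < norm x \<and> dist (f x) (poly_map Q t) < e"
        by (intro bexI conjI)
    qed
  qed
  \<comment> \<open>The exceptional parameters are reached by continuity: a cofinite set of reals is
    dense and the set of non-proper points is closed.\<close>
  have "poly_map Q ` closure (- ?Z) \<subseteq> nonproper_set X f"
    by (rule image_closure_subset[OF continuous_on_poly_map closed_nonproper_set[OF X contf]])
      (use generic in blast)
  moreover have "closure (- ?Z) = UNIV"
    using empty_interior_finite[OF Z] by (simp add: closure_complement)
  ultimately have "range (poly_map Q) \<subseteq> nonproper_set X f" by simp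
  moreover have "\<not> poly_map Q constant_on UNIV"
  proof
    assume "poly_map Q constant_on UNIV"
    then have "poly_map Q t = poly_map Q 0" for t unfolding constant_on_def by auto
    then have "(\<Sum>j\<le>?D. t ^ j *\<^sub>R A j) = A 0" for t unfolding Q(2) at0 .
    \<comment> \<open>Without its constant term the limit would vanish identically, yet its
      coefficient \<open>A i\<close> with \<open>i\<close> at least 1 is non-zero.\<close>
    then have "(\<Sum>j\<le>?D. t ^ j *\<^sub>R (A(0 := 0)) j) = 0" for t
      by (subst (asm) sum.remove[of _ 0], simp_all, subst sum.remove[of _ 0]) simp_all
    then have "{t. (\<Sum>j\<le>?D. t ^ j *\<^sub>R (A(0 := 0)) j) = 0} = UNIV" by blast
    moreover have "finite {t. (\<Sum>j\<le>?D. t ^ j *\<^sub>R (A(0 := 0)) j) = 0}"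
      using i by (intro finite_zeros_vector_poly[of i]) auto
    ultimately show False using infinite_UNIV_char_0 by metis
  qed
  moreover have "y \<in> range (poly_map Q)"
    using Q(2)[of 0] A0 by (metis at0 rangeI)
  ultimately show ?thesis
    unfolding parametric_curve_in_def using Q(1) by blast
qed

theorem theorem4p11:
  fixes X :: "(real ^ 'n::finite) set"
    and f :: "real ^ 'n \<Rightarrow> real ^ 'm::finite"
    and d1 d2 :: nat
  assumes "closed X"
    and "algebraic_set X"
    and "uniruledness_degree_le X d1"
    and "polynomial_map_on X f d2"
    and "generically_finite_on X f"
  shows "R_uniruled (nonproper_set X f) \<and>
         uniruledness_degree_le (nonproper_set X f) (2 * d1 * d2)"
proof -
  have "semialgebraic X" using assms(3) unfolding uniruledness_degree_le_def by blast
  then have "closed (nonproper_set X f)" "semialgebraic (nonproper_set X f)"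
    using closed_nonproper_set semialgebraic_nonproper_set continuous_on_polynomial_map assms(1,4)
    by blast+
  moreover have "\<exists>l. parametric_curve_in (nonproper_set X f) (2 * d1 * d2) l \<and> y \<in> l"
    if "y \<in> nonproper_set X f" for y
  proof -
    obtain l where l: "parametric_curve_in (nonproper_set X f) (d1 * d2) l" "y \<in> l"
      using parametric_curve_in_nonproper_set[OF assms(1,3,4,5) \<open>y \<in> nonproper_set X f\<close>] by blast
    have "d1 * d2 \<le> 2 * d1 * d2" by simp
    with l have "parametric_curve_in (nonproper_set X f) (2 * d1 * d2) l"
      unfolding parametric_curve_in_def by (blast intro: le_trans)
    with l(2) show ?thesis by blast
  qed
  ultimately have "uniruledness_degree_le (nonproper_set X f) (2 * d1 * d2)"
    unfolding uniruledness_degree_le_def by blast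
  then show ?thesis unfolding R_uniruled_def by blast
qed

end
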